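(* Let $m, r$ and $d$ be integers such that $d \geq 1$ and $2 \leq 2r \leq m-1$. Then $$\overline{\mathrm{POL}^{ss,neig}_{d,2r,m}}=\mathrm{POL}^{ss}_{d,2r,m}.$$
   Context: All matrix polynomials have coefficients in $\mathbb{C}$. The degree of a matrix polynomial is the largest power of $\lambda$ with a nonzero matrix coefficient. The (normal) rank of a matrix polynomial is its rank over the field $\mathbb{C}(\lambda)$. $\mathrm{POL}^{ss}_{d,m}$ is the vector space of $m\times m$ skew-symmetric matrix polynomials $P(\lambda)=\sum_{i=0}^d\lambda^iA_i$ ($A_i\in\mathbb{C}^{m\times m}$, $A_i^T=-A_i$) of degree at most $d$, equipped with the distance $d(P,P')=\left(\sum_{i=0}^d\|A_i-A_i'\|_F^2\right)^{1/2}$, where $P'(\lambda)=\sum_{i=0}^d\lambda^iA_i'$; $\overline{\mathcal{S}}$ denotes closure in the resulting (Euclidean) topology. $\mathrm{POL}^{ss}_{d,2r,m}$ is the set of $P\in\mathrm{POL}^{ss}_{d,m}$ with normal rank at most $2r$. Eigenvalues: $\alpha\in\mathbb{C}$ is a finite eigenvalue of $P(\lambda)$ if it is a root of at least one of the invariant polynomials of $P(\lambda)$ (the nonzero diagonal entries of its Smith form over $\mathbb{C}[\lambda]$); equivalently, $\operatorname{rank}P(\alpha)<\operatorname{rank}(P)$. $\infty$ is an eigenvalue of $P(\lambda)$, regarded as a polynomial of grade $d$, if $0$ is an eigenvalue of $\mathrm{rev}_dP(\lambda):=\lambda^dP(1/\lambda)$. "$P$ has no eigenvalues" means no finite and no infinite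 eigenvalues. Then $$\mathrm{POL}^{ss,neig}_{d,2r,m}:=\{P(\lambda)\in\mathrm{POL}^{ss}_{d,2r,m} : \operatorname{rank}(P)=2r,\ \deg(P)=d,\ P(\lambda)\text{ has no eigenvalues}\}.$$ *)

theory Defs
  imports
    "HOL-Analysis.Analysis"
    "HOL-Computational_Algebra.Polynomial_Factorial"
    "Jordan_Normal_Form.DL_Rank"
begin

text \<open>An \<open>m \<times> m\<close> matrix polynomial is a matrix with entries in \<open>\<complex>[\<lambda>]\<close>. The size \<open>m\<close> is passed
  explicitly to \<open>coeff_mat\<close> so that \<open>pol_dist\<close> below is symmetric on the whole type, as the
  locale \<open>Metric_space\<close> demands.\<close>

definition coeff_mat :: "nat \<Rightarrow> nat \<Rightarrow> complex poly mat \<Rightarrow> complex mat" where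
  "coeff_mat m i P = mat m m (\<lambda>jk. coeff (P $$ jk) i)"

text \<open>Unspecified for the zero matrix polynomial.\<close>

definition mat_poly_degree :: "nat \<Rightarrow> complex poly mat \<Rightarrow> nat" where
  "mat_poly_degree m P = (GREATEST i. coeff_mat m i P \<noteq> 0\<^sub>m m m)"

definition normal_rank :: "nat \<Rightarrow> complex poly mat \<Rightarrow> nat" where
  "normal_rank m P = vec_space.rank m (map_mat to_fract P)"

definition POL_ss :: "nat \<Rightarrow> nat \<Rightarrow> complex poly mat set" where
  "POL_ss d m = {P \<in> carrier_mat m m.
     (\<forall>i\<le>d. transpose_mat (coeff_mat m i P) = - coeff_mat m i P) \<and>
     (\<forall>i>d. coeff_mat m i P = 0\<^sub>m m m)}"

definition frobenius_norm :: "complex mat \<Rightarrow> real" where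
  "frobenius_norm A = sqrt (\<Sum>j<dim_row A. \<Sum>k<dim_col A. (cmod (A $$ (j, k)))\<^sup>2)"

definition pol_dist :: "nat \<Rightarrow> nat \<Rightarrow> complex poly mat \<Rightarrow> complex poly mat \<Rightarrow> real" where
  "pol_dist d m P P' =
     sqrt (\<Sum>i\<le>d. (frobenius_norm (coeff_mat m i P - coeff_mat m i P'))\<^sup>2)"

definition POL_ss_rank :: "nat \<Rightarrow> nat \<Rightarrow> nat \<Rightarrow> complex poly mat set" where
  "POL_ss_rank d k m = {P \<in> POL_ss d m. normal_rank m P \<le> k}"

text \<open>\<open>S\<close> is the Smith form of \<open>P\<close>: equivalent to \<open>P\<close> via unimodular matrices, diagonal, each
  diagonal entry dividing the next and the nonzero ones monic. As \<open>0\<close> divides only \<open>0\<close>, the zero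
  diagonal entries come last.\<close>

definition smith_form_of :: "complex poly mat \<Rightarrow> complex poly mat \<Rightarrow> bool" where
  "smith_form_of P S \<longleftrightarrow>
     (\<exists>U V. U \<in> carrier_mat (dim_row P) (dim_row P) \<and> invertible_mat U \<and>
            V \<in> carrier_mat (dim_col P) (dim_col P) \<and> invertible_mat V \<and> S = U * P * V) \<and>
     diagonal_mat S \<and>
     (\<forall>i. i + 1 < min (dim_row S) (dim_col S) \<longrightarrow> S $$ (i, i) dvd S $$ (i + 1, i + 1)) \<and>
     (\<forall>i < min (dim_row S) (dim_col S). S $$ (i, i) \<noteq> 0 \<longrightarrow> lead_coeff (S $$ (i, i)) = 1)"

definition invariant_polys :: "complex poly mat \<Rightarrow> complex poly set" where
  "invariant_polys P = {S $$ (i, i) | S i. smith_form_of P S \<and>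
     i < min (dim_row S) (dim_col S) \<and> S $$ (i, i) \<noteq> 0}"

definition finite_eigenvalue :: "complex poly mat \<Rightarrow> complex \<Rightarrow> bool" where
  "finite_eigenvalue P \<alpha> \<longleftrightarrow> (\<exists>p \<in> invariant_polys P. poly p \<alpha> = 0)"

text \<open>\<open>\<lambda>\<^sup>d P(1/\<lambda>)\<close>, for entries of degree at most \<open>d\<close>. The library's \<open>reflect_poly\<close> reverses with
  respect to the actual degree of each entry instead.\<close>

definition rev_mat_poly :: "nat \<Rightarrow> complex poly mat \<Rightarrow> complex poly mat" where
  "rev_mat_poly d P = map_mat (\<lambda>p. \<Sum>i\<le>d. monom (coeff p i) (d - i)) P"

definition infinite_eigenvalue :: "nat \<Rightarrow> complex poly mat \<Rightarrow> bool" where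
  "infinite_eigenvalue d P \<longleftrightarrow> finite_eigenvalue (rev_mat_poly d P) 0"

definition POL_ss_neig :: "nat \<Rightarrow> nat \<Rightarrow> nat \<Rightarrow> complex poly mat set" where
  "POL_ss_neig d k m = {P \<in> POL_ss_rank d k m.
     normal_rank m P = k \<and> mat_poly_degree m P = d \<and>
     (\<nexists>\<alpha>. finite_eigenvalue P \<alpha>) \<and> \<not> infinite_eigenvalue d P}"

lemma pol_dist_L2_set:
  "pol_dist d m P Q =
     L2_set (\<lambda>(i, j, k). cmod (coeff (P $$ (j, k)) i - coeff (Q $$ (j, k)) i))
       ({..d} \<times> {..<m} \<times> {..<m})"
proof -
  have "(frobenius_norm (coeff_mat m i P - coeff_mat m i Q))\<^sup>2 =
     (\<Sum>j<m. \<Sum>k<m. (cmod (coeff (P $$ (j, k)) i - coeff (Q $$ (j, k)) i))\<^sup>2)" for i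
    by (simp add: frobenius_norm_def coeff_mat_def sum_nonneg)
  then show ?thesis
    by (simp add: pol_dist_def L2_set_def sum.cartesian_product case_prod_unfold)
qed

lemma Metric_space_POL_ss: "Metric_space (POL_ss d m) (pol_dist d m)"
proof
  fix P Q R
  show "0 \<le> pol_dist d m P Q"
    by (simp add: pol_dist_L2_set)
  show "pol_dist d m P Q = pol_dist d m Q P"
    by (simp add: pol_dist_L2_set norm_minus_commute)
  show "pol_dist d m P Q = 0 \<longleftrightarrow> P = Q" if P: "P \<in> POL_ss d m" and Q: "Q \<in> POL_ss d m"
  proof
    assume "pol_dist d m P Q = 0"
    then have low: "coeff (P $$ (j, k)) i = coeff (Q $$ (j, k)) i" if "i \<le> d" "j < m" "k < m" for i j k
      using that by (auto simp: pol_dist_L2_set L2_set_eq_0_iff)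
    have high: "coeff (X $$ (j, k)) i = 0"
      if "X \<in> POL_ss d m" "i > d" "j < m" "k < m" for X i j k
    proof -
      have "coeff_mat m i X $$ (j, k) = 0"
        using that by (simp add: POL_ss_def)
      then show ?thesis using that by (simp add: coeff_mat_def)
    qed
    have "coeff (P $$ (j, k)) i = coeff (Q $$ (j, k)) i" if "j < m" "k < m" for i j k
      using low high[OF P] high[OF Q] that by (cases "i \<le> d") auto
    then show "P = Q"
      using P Q by (intro eq_matI) (auto simp: POL_ss_def poly_eq_iff)
  qed (simp add: pol_dist_L2_set L2_set_def case_prod_unfold)
  show "pol_dist d m P R \<le> pol_dist d m P Q + pol_dist d m Q R"
  proof -
    have "pol_dist d m P R \<le> L2_set (\<lambda>x.
        (case x of (i, j, k) \<Rightarrow> cmod (coeff (P $$ (j, k)) i - coeff (Q $$ (j, k)) i)) +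
        (case x of (i, j, k) \<Rightarrow> cmod (coeff (Q $$ (j, k)) i - coeff (R $$ (j, k)) i)))
       ({..d} \<times> {..<m} \<times> {..<m})"
      unfolding pol_dist_L2_set
    proof (rule L2_set_mono)
      fix x :: "nat \<times> nat \<times> nat"
      obtain i j k where x: "x = (i, j, k)" by (cases x)
      show "(case x of (i, j, k) \<Rightarrow> cmod (coeff (P $$ (j, k)) i - coeff (R $$ (j, k)) i)) \<le>
        (case x of (i, j, k) \<Rightarrow> cmod (coeff (P $$ (j, k)) i - coeff (Q $$ (j, k)) i)) +
        (case x of (i, j, k) \<Rightarrow> cmod (coeff (Q $$ (j, k)) i - coeff (R $$ (j, k)) i))"
        unfolding x prod.case by (rule norm_diff_triangle_le[OF order_refl order_refl])
    qed auto
    also have "\<dots> \<le> pol_dist d m P Q + pol_dist d m Q R"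
      unfolding pol_dist_L2_set by (rule L2_set_triangle_ineq)
    finally show ?thesis .
  qed
qed

end

theory Submission
  imports Defs "Jordan_Normal_Form.DL_Rank_Submatrix"
begin

text \<open>Rank at most \<open>2r\<close> is a closed condition, because it says that certain minors vanish.

  For density, write \<open>P = N\<^sup>T X N\<close> where row \<open>i\<close> of \<open>N\<close> has degree at most \<open>n\<^sub>i\<close> and \<open>X\<close> is
  skew-symmetric with entries of degree at most \<open>d - n\<^sub>i - n\<^sub>j\<close>, starting from \<open>N = I\<close>, \<open>X = P\<close>. If
  \<open>X(x) c = 0\<close> for some \<open>c \<noteq> 0\<close> at a point \<open>x\<close> of the projective line, choose \<open>i\<close> in the support of \<open>c\<close>
  with \<open>n\<^sub>i\<close> minimal and replace the \<open>i\<close>-th basis vector by \<open>c\<close> divided by a local parameter at \<open>x\<close>.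
  Skew-symmetry keeps \<open>X\<close> polynomial, and \<open>n\<^sub>i\<close> grows by one. Zero rows of \<open>X\<close> are dropped, and \<open>n\<^sub>i \<le> d\<close>
  for every nonzero row, so the process ends with \<open>X\<close> nonsingular at every point, infinity included. Its
  size is then even and equal to the rank of \<open>P\<close>; padding with hyperbolic pairs of degrees \<open>0\<close> and \<open>d\<close>
  gives size \<open>2r\<close>. As \<open>2r < m\<close>, an arbitrarily small perturbation makes the rows of \<open>N\<close> independent at
  every point of the projective line, and then \<open>N\<^sup>T X N\<close> has rank \<open>2r\<close> everywhere, that is, no eigenvalues.\<close>

unbundle no vec_syntax

section \<open>Linear algebra over finite index sets\<close>

text \<open>Rows and columns are indexed by sets rather than by matrix dimensions, since the
  arguments below keep selecting, dropping and adjoining indices.\<close>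

definition inj_cols :: "'r set \<Rightarrow> 'c set \<Rightarrow> ('r \<Rightarrow> 'c \<Rightarrow> 'a::comm_ring_1) \<Rightarrow> bool" where
  "inj_cols R J M \<longleftrightarrow> (\<forall>c. (\<forall>r\<in>R. (\<Sum>j\<in>J. M r j * c j) = 0) \<longrightarrow> (\<forall>j\<in>J. c j = 0))"

lemma inj_colsD:
  "inj_cols R J M \<Longrightarrow> (\<And>r. r \<in> R \<Longrightarrow> (\<Sum>j\<in>J. M r j * c j) = 0) \<Longrightarrow> j \<in> J \<Longrightarrow> c j = 0"
  unfolding inj_cols_def by blast

lemma inj_cols_cong:
  assumes "\<And>r j. r \<in> R \<Longrightarrow> j \<in> J \<Longrightarrow> M r j = M' r j"
  shows "inj_cols R J M \<longleftrightarrow> inj_cols R J M'"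
  using assms by (simp add: inj_cols_def cong: sum.cong)

lemma inj_cols_mono: "inj_cols R J M \<Longrightarrow> R \<subseteq> R' \<Longrightarrow> inj_cols R' J M"
  unfolding inj_cols_def by blast

text \<open>Gaussian elimination, one row at a time: a row that vanishes on \<open>J\<close> imposes
  no condition, and any other row removes one column through a pivot.\<close>

lemma not_inj_cols_if_card_less:
  fixes M :: "'r \<Rightarrow> 'c \<Rightarrow> 'a::field"
  assumes "finite R" "finite J" "card R < card J"
  shows "\<not> inj_cols R J M"
  using assms
proof (induction R arbitrary: J M rule: finite_induct)
  case empty
  then have "J \<noteq> {}" by auto
  then obtain j where j: "j \<in> J" by blast
  show ?case
    unfolding inj_cols_def not_all not_imp by (rule exI[of _ "\<lambda>_. 1"]) (use j in auto)
next
  case (insert e R)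
  show ?case
  proof (cases "\<forall>j\<in>J. M e j = 0")
    case True
    have "\<not> inj_cols R J M" using insert by simp
    then show ?thesis using True by (auto simp: inj_cols_def)
  next
    case False
    then obtain p where p: "p \<in> J" "M e p \<noteq> 0" by blast
    let ?J = "J - {p}"
    \<comment> \<open>Schur complement of the pivot entry \<open>M e p\<close>.\<close>
    define M' where "M' f j = M f j - M f p * M e j / M e p" for f j
    have "\<not> inj_cols R ?J M'"
      using insert p by (intro insert.IH) (auto simp: card_Diff_singleton)
    then obtain c j where c: "\<And>r. r \<in> R \<Longrightarrow> (\<Sum>j\<in>?J. M' r j * c j) = 0" and j: "j \<in> ?J" "c j \<noteq> 0"
      unfolding inj_cols_def by blast
    define s where "s = (\<Sum>j\<in>?J. M e j * c j)"
    \<comment> \<open>The pivot coordinate is chosen to solve row \<open>e\<close>; the other rows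
      then reduce to those of \<open>M'\<close>.\<close>
    define c' where "c' = c(p := - s / M e p)"
    have split: "(\<Sum>j\<in>J. M r j * c' j) = M r p * (- s / M e p) + (\<Sum>j\<in>?J. M r j * c j)" for r
      using p insert.prems(1) by (simp add: sum.remove[of J p] c'_def)
    have "(\<Sum>j\<in>J. M r j * c' j) = 0" if "r \<in> insert e R" for r
    proof (cases "r = e")
      case True then show ?thesis using p by (simp add: split s_def)
    next
      case False
      then have "(\<Sum>j\<in>?J. M' r j * c j) = 0" using that c by simp
      moreover have "(\<Sum>j\<in>?J. M' r j * c j) = (\<Sum>j\<in>?J. M r j * c j) - M r p / M e p * s"
        unfolding s_def M'_def sum_distrib_left sum_subtractf[symmetric]
        by (intro sum.cong) (auto simp: algebra_simps)
      ultimately show ?thesis by (simp add: split)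
    qed
    moreover have "c' j \<noteq> 0" "j \<in> J" using j by (auto simp: c'_def)
    ultimately show ?thesis unfolding inj_cols_def by blast
  qed
qed

text \<open>Dividing the relation \<open>y\<close> by \<open>y p\<close> writes row \<open>p\<close>
  as a combination of the other rows, so its equation follows from theirs.\<close>

lemma inj_cols_remove_redundant_row:
  fixes M :: "'r \<Rightarrow> 'c \<Rightarrow> 'a::field"
  assumes inj: "inj_cols R J M" and "finite R"
    and y: "\<And>j. j \<in> J \<Longrightarrow> (\<Sum>r\<in>R. M r j * y r) = 0" and p: "p \<in> R" "y p \<noteq> 0"
  shows "inj_cols (R - {p}) J M"
  unfolding inj_cols_def
proof (intro allI impI)
  fix c assume c: "\<forall>r\<in>R - {p}. (\<Sum>j\<in>J. M r j * c j) = 0"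
  have "y p * (\<Sum>j\<in>J. M p j * c j) = (\<Sum>r\<in>R. y r * (\<Sum>j\<in>J. M r j * c j))"
    using c p \<open>finite R\<close> by (simp add: sum.remove[of R p])
  also have "\<dots> = (\<Sum>j\<in>J. c j * (\<Sum>r\<in>R. M r j * y r))"
    by (simp add: sum_distrib_left sum.swap[of _ J R] mult_ac)
  also have "\<dots> = 0" using y by simp
  finally have "(\<Sum>j\<in>J. M p j * c j) = 0" using p by simp
  then have "\<forall>r\<in>R. (\<Sum>j\<in>J. M r j * c j) = 0" using c by auto
  then show "\<forall>j\<in>J. c j = 0" using inj unfolding inj_cols_def by blast
qed

text \<open>Row rank equals column rank: while there are more rows than columns, the transposed
  system has a nontrivial solution, that is, a relation among the rows, and a row in its support can
  be discarded.\<close>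

lemma inj_cols_select_rows:
  fixes M :: "'r \<Rightarrow> 'c \<Rightarrow> 'a::field"
  assumes "finite R" "finite J" "inj_cols R J M"
  obtains R' where "R' \<subseteq> R" "card R' = card J" "inj_cols R' J M"
proof -
  have "\<exists>R'\<subseteq>R. card R' = card J \<and> inj_cols R' J M"
    using assms(1,3)
  proof (induction R rule: finite_psubset_induct)
    case (psubset R)
    have "\<not> card R < card J"
      using not_inj_cols_if_card_less[of R J M] psubset.hyps psubset.prems assms(2) by auto
    then consider "card R = card J" | "card J < card R" by linarith
    then show ?case
    proof cases
      case 1 then show ?thesis using psubset.prems by blast
    next
      case 2
      then obtain y p where y: "\<And>j. j \<in> J \<Longrightarrow> (\<Sum>r\<in>R. M r j * y r) = 0" and p: "p \<in> R" "y p \<noteq> 0"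
        using not_inj_cols_if_card_less[of J R "\<lambda>j r. M r j"] assms(2) psubset.hyps
        unfolding inj_cols_def by blast
      then have "inj_cols (R - {p}) J M"
        by (intro inj_cols_remove_redundant_row[where y = y]) (use psubset in auto)
      then obtain R' where "R' \<subseteq> R - {p}" "card R' = card J" "inj_cols R' J M"
        using psubset.IH[of "R - {p}"] p by blast
      then show ?thesis by blast
    qed
  qed
  then show ?thesis using that by blast
qed

text \<open>A relation among the rows would allow one of them to be discarded, leaving independent
  columns with fewer rows than columns.\<close>

lemma inj_cols_transpose:
  fixes M :: "'r \<Rightarrow> 'c \<Rightarrow> 'a::field"
  assumes "finite R" "finite J" "card R = card J" "inj_cols R J M"
  shows "inj_cols J R (\<lambda>j r. M r j)"
proof (rule ccontr)
  assume "\<not> ?thesis"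
  then obtain y p where y: "\<And>j. j \<in> J \<Longrightarrow> (\<Sum>r\<in>R. M r j * y r) = 0" and p: "p \<in> R" "y p \<noteq> 0"
    unfolding inj_cols_def by blast
  then have "inj_cols (R - {p}) J M"
    by (intro inj_cols_remove_redundant_row[where y = y]) (use assms in auto)
  moreover have "card (R - {p}) < card J"
    using p assms by (metis card_Diff1_less)
  ultimately show False
    using not_inj_cols_if_card_less[of "R - {p}" J M] assms by auto
qed

section \<open>Minors, independent columns and rank\<close>

lemma bij_betw_pick:
  assumes "J \<subseteq> {..<m}"
  shows "bij_betw (pick J) {..<card J} J"
proof -
  have fin: "finite J" using assms finite_subset by auto
  have "inj_on (pick J) {..<card J}"
    using pick_mono_le by (intro linorder_inj_onI') (metis lessThan_iff less_irrefl)
  moreover have "pick J ` {..<card J} \<subseteq> J" using pick_in_set_le by auto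
  ultimately show ?thesis
    using fin by (simp add: bij_betw_def card_image card_subset_eq)
qed

lemma submatrix_carrier_subset:
  assumes "A \<in> carrier_mat m n" "R \<subseteq> {..<m}" "J \<subseteq> {..<n}"
  shows "submatrix A R J \<in> carrier_mat (card R) (card J)"
proof -
  have "{i. i < m \<and> i \<in> R} = R" "{j. j < n \<and> j \<in> J} = J" using assms by auto
  then show ?thesis using assms by (auto simp: dim_submatrix)
qed

lemma submatrix_index_subset:
  assumes "A \<in> carrier_mat m n" "R \<subseteq> {..<m}" "J \<subseteq> {..<n}" "i < card R" "j < card J"
  shows "submatrix A R J $$ (i, j) = A $$ (pick R i, pick J j)"
proof -
  have "{i. i < m \<and> i \<in> R} = R" "{j. j < n \<and> j \<in> J} = J" using assms by auto
  then show ?thesis using assms by (simp add: submatrix_index)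
qed

text \<open>The bridge between minors and independent columns: over an integral domain a determinant
  vanishes iff the matrix kills a nonzero vector, and \<open>pick\<close> carries the coordinates of
  that vector to the index set \<open>J\<close>.\<close>

lemma det_submatrix_neq_0_iff:
  fixes A :: "'a::idom mat"
  assumes A: "A \<in> carrier_mat m n" and R: "R \<subseteq> {..<m}" and J: "J \<subseteq> {..<n}" and card: "card R = card J"
  shows "det (submatrix A R J) \<noteq> 0 \<longleftrightarrow> inj_cols R J (\<lambda>i j. A $$ (i, j))"
proof -
  let ?S = "submatrix A R J" and ?k = "card J"
  have S: "?S \<in> carrier_mat ?k ?k" using submatrix_carrier_subset[OF A R J] card by simp
  have bR: "bij_betw (pick R) {..<?k} R" and bJ: "bij_betw (pick J) {..<?k} J"
    using bij_betw_pick[OF R] bij_betw_pick[OF J] card by auto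
  have prod: "(?S *\<^sub>v v) $ i = (\<Sum>j\<in>J. A $$ (pick R i, j) * c j)"
    if "v \<in> carrier_vec ?k" "i < ?k" "\<And>j. j < ?k \<Longrightarrow> v $ j = c (pick J j)" for v c i
  proof -
    have "(?S *\<^sub>v v) $ i = (\<Sum>j<?k. ?S $$ (i, j) * v $ j)"
      using S that(1,2) by (auto simp: scalar_prod_def lessThan_atLeast0 intro!: sum.cong)
    also have "\<dots> = (\<Sum>j<?k. A $$ (pick R i, pick J j) * c (pick J j))"
      using that card by (intro sum.cong) (auto simp: submatrix_index_subset[OF A R J])
    also have "\<dots> = (\<Sum>j\<in>J. A $$ (pick R i, j) * c j)"
      by (rule sum.reindex_bij_betw[OF bJ])
    finally show ?thesis .
  qed
  show ?thesis
  proof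
    assume nz: "det ?S \<noteq> 0"
    show "inj_cols R J (\<lambda>i j. A $$ (i, j))"
      unfolding inj_cols_def
    proof (intro allI impI ballI)
      fix c j assume c: "\<forall>r\<in>R. (\<Sum>j\<in>J. A $$ (r, j) * c j) = 0" and j: "j \<in> J"
      define v where "v = vec ?k (\<lambda>j. c (pick J j))"
      have v: "v \<in> carrier_vec ?k" by (simp add: v_def)
      have "?S *\<^sub>v v = 0\<^sub>v ?k"
      proof (rule eq_vecI)
        fix i assume "i < dim_vec (0\<^sub>v ?k)"
        then show "(?S *\<^sub>v v) $ i = 0\<^sub>v ?k $ i"
          using c prod[OF v, of i c] bij_betwE[OF bR] by (auto simp: v_def)
      qed (use S in simp)
      then have "v = 0\<^sub>v ?k" using nz v det_0_iff_vec_prod_zero[OF S] by blast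
      moreover have "j \<in> pick J ` {..<?k}" using bJ j by (simp add: bij_betw_def)
      then obtain i where "i < ?k" "j = pick J i" by auto
      ultimately show "c j = 0" by (metis v_def index_vec index_zero_vec(1))
    qed
  next
    assume inj: "inj_cols R J (\<lambda>i j. A $$ (i, j))"
    show "det ?S \<noteq> 0"
    proof
      assume "det ?S = 0"
      then obtain v where v: "v \<in> carrier_vec ?k" "v \<noteq> 0\<^sub>v ?k" "?S *\<^sub>v v = 0\<^sub>v ?k"
        using det_0_iff_vec_prod_zero[OF S] by blast
      define c where "c j = v $ (inv_into {..<?k} (pick J) j)" for j
      have cv: "v $ j = c (pick J j)" if "j < ?k" for j
        using bJ that by (simp add: c_def bij_betw_def inv_into_f_f)
      have "(\<Sum>j\<in>J. A $$ (r, j) * c j) = 0" if "r \<in> R" for r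
      proof -
        have "r \<in> pick R ` {..<?k}" using bR that by (simp add: bij_betw_def)
        then obtain i where i: "i < ?k" "r = pick R i" by auto
        have "(?S *\<^sub>v v) $ i = (\<Sum>j\<in>J. A $$ (pick R i, j) * c j)" by (rule prod[OF v(1) i(1) cv])
        then show ?thesis using v(3) i by simp
      qed
      then have "c j = 0" if "j \<in> J" for j
        using inj that unfolding inj_cols_def by blast
      then have "v = 0\<^sub>v ?k"
        using v(1) cv bij_betwE[OF bJ] by (intro eq_vecI) auto
      then show False using v(2) by simp
    qed
  qed
qed

text \<open>Transposition gives \<open>det S = (-1)^k * det S\<close> with \<open>k\<close> odd, so
  the determinant vanishes in characteristic zero. This will force the final \<open>X\<close> to
  have even size.\<close>

lemma skew_odd_not_inj_cols:
  fixes M :: "nat \<Rightarrow> nat \<Rightarrow> 'a::field_char_0"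
  assumes I: "I \<subseteq> {..<m}" and odd: "odd (card I)" and skew: "\<And>i j. i \<in> I \<Longrightarrow> j \<in> I \<Longrightarrow> M j i = - M i j"
  shows "\<not> inj_cols I I M"
proof -
  define A where "A = mat m m (\<lambda>(i, j). M i j)"
  have A: "A \<in> carrier_mat m m" by (simp add: A_def)
  let ?S = "submatrix A I I" and ?k = "card I"
  have S: "?S \<in> carrier_mat ?k ?k" using submatrix_carrier_subset[OF A I I] .
  have pick: "pick I i \<in> I" if "i < ?k" for i using pick_in_set_le that by auto
  have "transpose_mat ?S = (- 1) \<cdot>\<^sub>m ?S"
  proof (rule eq_matI)
    fix i j assume "i < dim_row ((- 1) \<cdot>\<^sub>m ?S)" "j < dim_col ((- 1) \<cdot>\<^sub>m ?S)"
    then have ij: "i < ?k" "j < ?k" using S by auto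
    then have "pick I i < m" "pick I j < m" using pick I by blast+
    then show "transpose_mat ?S $$ (i, j) = ((- 1) \<cdot>\<^sub>m ?S) $$ (i, j)"
      using ij S skew[OF pick[OF ij(1)] pick[OF ij(2)]]
      by (simp add: submatrix_index_subset[OF A I I]) (simp add: A_def)
  qed (use S in auto)
  then have "det ?S = (- 1) ^ ?k * det ?S"
    using det_transpose[OF S] S by (metis det_smult carrier_matD(2))
  then have "det ?S = 0" using odd by simp
  then have "\<not> inj_cols I I (\<lambda>i j. A $$ (i, j))"
    using det_submatrix_neq_0_iff[OF A I I] by blast
  moreover have "inj_cols I I (\<lambda>i j. A $$ (i, j)) \<longleftrightarrow> inj_cols I I M"
    using I by (intro inj_cols_cong) (auto simp: A_def subset_iff)
  ultimately show ?thesis by simp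
qed

text \<open>Turns the rank, computed from a maximal independent set of column vectors, into a set of
  column indices.\<close>

lemma (in vec_space) rank_indep_cols:
  assumes A: "A \<in> carrier_mat n nc"
  obtains J where "J \<subseteq> {..<nc}" "card J = rank A" "inj_cols {..<n} J (\<lambda>i j. A $$ (i, j))"
proof -
  have "lin_indpt {}" by (rule finite_lin_indpt2) auto
  then obtain S where S: "maximal S (\<lambda>T. T \<subseteq> set (cols A) \<and> lin_indpt T)"
    using maximal_exists_superset[of "set (cols A)" "\<lambda>T. T \<subseteq> set (cols A) \<and> lin_indpt T" "{}"]
    by auto
  then have rank: "rank A = card S" and sub: "S \<subseteq> set (cols A)" and ind: "lin_indpt S"
    using rank_card_indpt[OF A] by (auto simp: maximal_def)
  have "S \<subseteq> col A ` {..<nc}" using sub A by (auto simp: cols_def)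
  \<comment> \<open>The same vector may occur as a column at several indices, so one index is chosen
    for each vector in \<open>S\<close>.\<close>
  then obtain J where J: "J \<subseteq> {..<nc}" and inj: "inj_on (col A) J" and SJ: "S = col A ` J"
    by (meson subset_image_inj)
  have bJ: "bij_betw (pick J) {..<card J} J" using bij_betw_pick[OF J] .
  define B where "B = mat n (card J) (\<lambda>(i, j). A $$ (i, pick J j))"
  have B: "B \<in> carrier_mat n (card J)" by (simp add: B_def)
  have colB: "col B j = col A (pick J j)" if "j < card J" for j
  proof -
    have "pick J j < nc" using that J bij_betwE[OF bJ] by blast
    then show ?thesis using that A by (intro eq_vecI) (auto simp: B_def)
  qed
  have colsB: "cols B = map (\<lambda>j. col A (pick J j)) [0..<card J]"
    using B colB by (auto simp: cols_def)
  have "inj_on (\<lambda>j. col A (pick J j)) {..<card J}"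
    using inj bJ comp_inj_on[of "pick J" "{..<card J}" "col A"] by (simp add: bij_betw_def comp_def)
  then have dist: "distinct (cols B)"
    unfolding colsB distinct_map by (simp add: lessThan_atLeast0)
  have setB: "set (cols B) = S"
    using image_image[of "col A" "pick J" "{..<card J}"] bJ
    unfolding colsB SJ bij_betw_def by (simp add: lessThan_atLeast0)
  have "inj_cols {..<n} J (\<lambda>i j. A $$ (i, j))"
    unfolding inj_cols_def
  proof (intro allI impI ballI)
    fix c j assume c: "\<forall>i\<in>{..<n}. (\<Sum>j\<in>J. A $$ (i, j) * c j) = 0" and j: "j \<in> J"
    define v where "v = vec (card J) (\<lambda>j. c (pick J j))"
    have "(B *\<^sub>v v) $ i = 0" if i: "i < n" for i
    proof -
      have "(B *\<^sub>v v) $ i = (\<Sum>j<card J. A $$ (i, pick J j) * c (pick J j))"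
        using i B by (auto simp: scalar_prod_def v_def B_def lessThan_atLeast0 intro!: sum.cong)
      also have "\<dots> = (\<Sum>j\<in>J. A $$ (i, j) * c j)" by (rule sum.reindex_bij_betw[OF bJ])
      finally show ?thesis using c i by simp
    qed
    then have "B *\<^sub>v v = 0\<^sub>v n" using B by (intro eq_vecI) auto
    then have "v = 0\<^sub>v (card J)"
      using lin_depI[OF B _ _ _ dist, of v] ind setB by (auto simp: v_def)
    moreover have "j \<in> pick J ` {..<card J}" using bJ j by (simp add: bij_betw_def)
    then obtain i where "i < card J" "j = pick J i" by auto
    ultimately show "c j = 0" by (metis v_def index_vec index_zero_vec(1))
  qed
  moreover have "card J = rank A" using rank SJ inj card_image by metis
  ultimately show ?thesis using that J by blast
qed

section \<open>Skew-symmetric representations\<close>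

definition grade_le :: "int \<Rightarrow> complex poly \<Rightarrow> bool" where
  "grade_le n p \<longleftrightarrow> (\<forall>i. n < int i \<longrightarrow> coeff p i = 0)"

text \<open>Value of a polynomial of grade \<open>n\<close> at a point of the projective line; \<open>None\<close> is the point at infinity.
  Grades are integers because the grade \<open>d - n\<^sub>i - n\<^sub>j\<close> of a zero entry may be negative.\<close>

definition grade_eval :: "int \<Rightarrow> complex option \<Rightarrow> complex poly \<Rightarrow> complex" where
  "grade_eval n x p = (case x of Some \<alpha> \<Rightarrow> poly p \<alpha> | None \<Rightarrow> if n < 0 then 0 else coeff p (nat n))"

lemma grade_eval_Some [simp]: "grade_eval n (Some \<alpha>) p = poly p \<alpha>"
  by (simp add: grade_eval_def)

lemma grade_le_iff_degree: "grade_le n p \<longleftrightarrow> p = 0 \<or> int (degree p) \<le> n"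
proof
  assume *: "grade_le n p"
  have "int (degree p) \<le> n" if "p \<noteq> 0"
    using * that unfolding grade_le_def by (meson leading_coeff_0_iff not_le)
  then show "p = 0 \<or> int (degree p) \<le> n" by blast
next
  assume "p = 0 \<or> int (degree p) \<le> n"
  then show "grade_le n p" unfolding grade_le_def by (auto simp: coeff_eq_0)
qed

lemma grade_le_0 [simp]: "grade_le n 0"
  and grade_le_add: "grade_le n p \<Longrightarrow> grade_le n q \<Longrightarrow> grade_le n (p + q)"
  and grade_le_diff: "grade_le n p \<Longrightarrow> grade_le n q \<Longrightarrow> grade_le n (p - q)"
  and grade_le_minus: "grade_le n p \<Longrightarrow> grade_le n (- p)"
  and grade_le_const: "0 \<le> n \<Longrightarrow> grade_le n [:c:]"
  by (auto simp: grade_le_def coeff_pCons split: nat.splits)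

lemma grade_le_sum: "(\<And>i. i \<in> I \<Longrightarrow> grade_le n (f i)) \<Longrightarrow> grade_le n (sum f I)"
  by (simp add: grade_le_def coeff_sum)

lemma grade_le_mult: "grade_le a p \<Longrightarrow> grade_le b q \<Longrightarrow> grade_le (a + b) (p * q)"
  unfolding grade_le_iff_degree by (cases "p = 0 \<or> q = 0") (auto simp: degree_mult_eq)

lemma coeff_mult_top:
  fixes p q :: "'a::comm_semiring_0 poly"
  assumes p: "\<And>i. i > a \<Longrightarrow> coeff p i = 0" and q: "\<And>i. i > b \<Longrightarrow> coeff q i = 0"
  shows "coeff (p * q) (a + b) = coeff p a * coeff q b"
proof -
  have "coeff p i * coeff q (a + b - i) = 0" if "i \<noteq> a" for i
    using p[of i] q[of "a + b - i"] that by (cases "i > a") auto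
  then have "(\<Sum>i\<le>a + b. coeff p i * coeff q (a + b - i)) = (\<Sum>i\<in>{a}. coeff p i * coeff q (a + b - i))"
    by (intro sum.mono_neutral_right) auto
  then show ?thesis by (simp add: coeff_mult)
qed

lemma grade_eval_0 [simp]: "grade_eval n x 0 = 0"
  and grade_eval_add: "grade_eval n x (p + q) = grade_eval n x p + grade_eval n x q"
  by (auto simp: grade_eval_def split: option.splits)

lemma grade_eval_sum: "grade_eval n x (sum f I) = (\<Sum>i\<in>I. grade_eval n x (f i))"
  by (auto simp: grade_eval_def coeff_sum poly_sum split: option.splits)

text \<open>At infinity this is \<open>coeff_mult_top\<close>. Nonzero factors have nonnegative
  grades, so \<open>nat\<close> loses nothing; zero factors are treated apart.\<close>

lemma grade_eval_mult:
  assumes p: "grade_le a p" and q: "grade_le b q"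
  shows "grade_eval (a + b) x (p * q) = grade_eval a x p * grade_eval b x q"
proof (cases "x = None \<and> p \<noteq> 0 \<and> q \<noteq> 0")
  case True
  then have "0 \<le> a" "0 \<le> b" using p q by (auto simp: grade_le_iff_degree)
  moreover have "coeff (p * q) (nat a + nat b) = coeff p (nat a) * coeff q (nat b)"
    using p q by (intro coeff_mult_top) (auto simp: grade_le_def)
  ultimately show ?thesis using True by (simp add: grade_eval_def nat_add_distrib)
qed (auto simp: grade_eval_def split: option.splits)

lemma grade_eval_mult3:
  assumes "grade_le a p" "grade_le b q" "grade_le c r" "e = a + b + c"
  shows "grade_eval e x (p * q * r) = grade_eval a x p * grade_eval b x q * grade_eval c x r"
  using assms by (simp add: grade_eval_mult grade_le_mult)

text \<open>In homogeneous coordinates the parameter is \<open>\<lambda> - \<alpha> \<mu>\<close> at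
  a finite point and \<open>\<mu>\<close> at infinity, and the latter becomes 1 on setting
  \<open>\<mu> = 1\<close>. Dividing by it at infinity therefore changes only the grade.\<close>

definition local_parameter :: "complex option \<Rightarrow> complex poly" where
  "local_parameter x = (case x of Some \<alpha> \<Rightarrow> [:- \<alpha>, 1:] | None \<Rightarrow> 1)"

lemma local_parameter_nonzero: "local_parameter x \<noteq> 0"
  and grade_le_local_parameter: "grade_le 1 (local_parameter x)"
  by (auto simp: local_parameter_def grade_le_iff_degree split: option.splits)

text \<open>At a finite point a linear factor splits off. At infinity the coefficient at the grade
  is zero, so \<open>p\<close> itself already has the smaller grade.\<close>

lemma grade_eval_eq_0_imp_factor:
  assumes "grade_le n p" "grade_eval n x p = 0"
  obtains q where "grade_le (n - 1) q" "p = local_parameter x * q"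
proof (cases x)
  case None
  have "coeff p i = 0" if "n - 1 < int i" for i
  proof (cases "n = int i")
    case True
    then show ?thesis using assms(2) None by (auto simp: grade_eval_def)
  next
    case False
    then show ?thesis using assms(1) that by (auto simp: grade_le_def)
  qed
  then show ?thesis using None that[of p] by (auto simp: grade_le_def local_parameter_def)
next
  case (Some \<alpha>)
  then have "[:- \<alpha>, 1:] dvd p" using assms(2) by (simp add: poly_eq_0_iff_dvd)
  then obtain q where q: "p = [:- \<alpha>, 1:] * q" by (elim dvdE)
  have "grade_le (n - 1) q"
  proof (cases "q = 0")
    case False
    then have "degree p = 1 + degree q" unfolding q by (subst degree_mult_eq) auto
    moreover have "p \<noteq> 0" using False q by (metis mult_eq_0_iff pCons_eq_0_iff one_neq_zero)
    ultimately show ?thesis using assms(1) by (auto simp: grade_le_iff_degree)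
  qed simp
  then show ?thesis using that q Some by (simp add: local_parameter_def)
qed

definition grade_lift :: "int \<Rightarrow> complex option \<Rightarrow> complex \<Rightarrow> complex poly" where
  "grade_lift n x c = (case x of Some _ \<Rightarrow> [:c:] | None \<Rightarrow> monom c (nat n))"

lemma grade_lift:
  assumes "0 \<le> n"
  shows "grade_le n (grade_lift n x c)" "grade_eval n x (grade_lift n x c) = c"
  using assms by (auto simp: grade_lift_def grade_le_def grade_eval_def coeff_pCons
      split: option.splits nat.splits)

lemma grade_lift_0_1: "grade_lift 0 x 1 = 1"
  by (auto simp: grade_lift_def split: option.splits)

text \<open>The row grades make every summand \<open>N i a * X i j * N j b\<close> a form of grade
  \<open>d\<close>, so the factorisation can also be evaluated at infinity.\<close>

definition skew_rep :: "nat \<Rightarrow> nat \<Rightarrow> (nat \<Rightarrow> nat \<Rightarrow> complex poly) \<Rightarrow> nat set \<Rightarrow> (nat \<Rightarrow> int) \<Rightarrow>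
    (nat \<Rightarrow> nat \<Rightarrow> complex poly) \<Rightarrow> (nat \<Rightarrow> nat \<Rightarrow> complex poly) \<Rightarrow> bool" where
  "skew_rep d m P I n N X \<longleftrightarrow> I \<subseteq> {..<m} \<and> (\<forall>i\<in>I. 0 \<le> n i) \<and>
     (\<forall>i\<in>I. \<forall>a<m. grade_le (n i) (N i a)) \<and>
     (\<forall>i\<in>I. \<forall>j\<in>I. grade_le (int d - n i - n j) (X i j)) \<and>
     (\<forall>i\<in>I. \<forall>j\<in>I. X j i = - X i j) \<and>
     (\<forall>a<m. \<forall>b<m. P a b = (\<Sum>i\<in>I. \<Sum>j\<in>I. N i a * X i j * N j b))"

text \<open>The reduction multiplies a row of \<open>N\<close> by a local parameter, which can
  destroy independence at a point. Independence off a finite set survives, and it suffices to bound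
  the size of a nonsingular \<open>X\<close> by the normal rank of \<open>P\<close>.\<close>

definition generically_indep :: "nat \<Rightarrow> nat set \<Rightarrow> (nat \<Rightarrow> nat \<Rightarrow> complex poly) \<Rightarrow> bool" where
  "generically_indep m I N \<longleftrightarrow>
     (\<exists>Z. finite Z \<and> (\<forall>\<alpha>. \<alpha> \<notin> Z \<longrightarrow> inj_cols {..<m} I (\<lambda>a i. poly (N i a) \<alpha>)))"

section \<open>Reduction at a singular point and its termination\<close>

lemma skew_form_swap:
  fixes X :: "nat \<Rightarrow> nat \<Rightarrow> 'a::comm_ring_1"
  assumes "\<And>i j. i \<in> I \<Longrightarrow> j \<in> I \<Longrightarrow> X j i = - X i j"
  shows "(\<Sum>i\<in>I. \<Sum>j\<in>I. f i * X i j * g j) = - (\<Sum>i\<in>I. \<Sum>j\<in>I. g i * X i j * f j)"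
proof -
  have "(\<Sum>i\<in>I. \<Sum>j\<in>I. f i * X i j * g j) = (\<Sum>j\<in>I. \<Sum>i\<in>I. f i * X i j * g j)" by (rule sum.swap)
  also have "\<dots> = (\<Sum>j\<in>I. \<Sum>i\<in>I. - (g j * X j i * f i))"
  proof (intro sum.cong refl)
    fix j i assume "j \<in> I" "i \<in> I"
    then have "X i j = - X j i" using assms by blast
    then show "f i * X i j * g j = - (g j * X j i * f i)" by simp
  qed
  finally show ?thesis by (simp add: sum_negf)
qed

text \<open>A change of basis that replaces the basis vector \<open>i\<close> by
  \<open>C / l\<close>. Since \<open>X C = l y\<close>, the new row and column \<open>i\<close>
  consist of the polynomials \<open>y\<close> up to sign, and the diagonal entry
  \<open>C\<^sup>T X C / l\<^sup>2\<close> is zero by skew-symmetry. \<open>N\<close> is multiplied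
  by the inverse base change, which is polynomial because \<open>C i = 1\<close>.\<close>

lemma skew_rep_transform:
  fixes l :: "complex poly"
  assumes rep: "skew_rep d m P I n N X" and gen: "generically_indep m I N"
    and i: "i \<in> I" and C: "\<And>j. j \<in> I \<Longrightarrow> grade_le (n j - n i) (C j)" "C i = 1"
    and y: "\<And>k. k \<in> I \<Longrightarrow> grade_le (int d - n k - n i - 1) (y k)"
    and XC: "\<And>k. k \<in> I \<Longrightarrow> (\<Sum>j\<in>I. X k j * C j) = l * y k"
    and l: "l \<noteq> 0" "grade_le 1 l"
  shows "\<exists>N' X'. skew_rep d m P I (n(i := n i + 1)) N' X' \<and> generically_indep m I N'"
proof -
  have I: "I \<subseteq> {..<m}" and n: "\<And>j. j \<in> I \<Longrightarrow> 0 \<le> n j"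
    and N: "\<And>j a. j \<in> I \<Longrightarrow> a < m \<Longrightarrow> grade_le (n j) (N j a)"
    and X: "\<And>j k. j \<in> I \<Longrightarrow> k \<in> I \<Longrightarrow> grade_le (int d - n j - n k) (X j k)"
    and skew: "\<And>j k. j \<in> I \<Longrightarrow> k \<in> I \<Longrightarrow> X k j = - X j k"
    and P: "\<And>a b. a < m \<Longrightarrow> b < m \<Longrightarrow> P a b = (\<Sum>i\<in>I. \<Sum>j\<in>I. N i a * X i j * N j b)"
    using rep unfolding skew_rep_def by blast+
  have fin: "finite I" using I finite_subset by blast
  define X' where "X' j k = (if j = i then (if k = i then 0 else - y k) else if k = i then y j else X j k)" for j k
  define N' where "N' j a = (if j = i then l * N i a else N j a - C j * N i a)" for j a
  define T where "T f g = (\<Sum>j\<in>I. \<Sum>k\<in>I. f j * X j k * g k)" for f g :: "nat \<Rightarrow> complex poly"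
  have Tswap: "T f g = - T g f" for f g unfolding T_def by (rule skew_form_swap[OF skew])
  have TCC: "T C C = 0"
  proof -
    have "T C C + T C C = 0" by (rule eq_neg_iff_add_eq_0[THEN iffD1, OF Tswap])
    then have "2 * T C C = 0" by (simp only: mult_2)
    then show ?thesis by simp
  qed
  have Tleft: "T (\<lambda>j. f j - C j * s) g = T f g - s * T C g" for f g s
    by (simp add: T_def algebra_simps sum_subtractf sum_distrib_left)
  have Tright: "T g (\<lambda>j. f j - C j * s) = T g f - s * T g C" for f g s
    by (simp add: T_def algebra_simps sum_subtractf sum_distrib_left)
  have TC: "T f C = (\<Sum>j\<in>I. f j * (l * y j))" for f
    by (simp add: T_def mult.assoc sum_distrib_left[symmetric] XC)
  have P': "P a b = (\<Sum>j\<in>I. \<Sum>k\<in>I. N' j a * X' j k * N' k b)" if "a < m" "b < m" for a b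
  proof -
    \<comment> \<open>Outside index \<open>i\<close> the columns \<open>a\<close> and
      \<open>b\<close> of \<open>N'\<close> are \<open>u\<close> and \<open>v\<close>. Both vanish
      at \<open>i\<close>, so the new form is the old one in \<open>u\<close> and \<open>v\<close>
      plus the contributions of column \<open>i\<close> and row \<open>i\<close> of
      \<open>X'\<close>.\<close>
    define u where "u j = N j a - C j * N i a" for j
    define v where "v j = N j b - C j * N i b" for j
    have [simp]: "u i = 0" "v i = 0" using C(2) by (auto simp: u_def v_def)
    have summand: "N' j a * X' j k * N' k b = u j * X j k * v k
        + (if k = i then u j * (l * y j) * N i b else 0) - (if j = i then N i a * (l * y k) * v k else 0)" for j k
      by (cases "j = i"; cases "k = i") (auto simp: N'_def X'_def u_def[symmetric] v_def[symmetric])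
    have "(\<Sum>j\<in>I. \<Sum>k\<in>I. N' j a * X' j k * N' k b)
        = T u v + T u C * N i b - N i a * T v C"
    proof -
      have "(\<Sum>j\<in>I. \<Sum>k\<in>I. if j = i then N i a * (l * y k) * v k else 0) = N i a * T v C"
        using fin i by (subst sum.swap) (simp add: TC sum_distrib_left mult_ac)
      moreover have "(\<Sum>j\<in>I. \<Sum>k\<in>I. if k = i then u j * (l * y j) * N i b else 0) = T u C * N i b"
        using fin i by (simp add: TC sum_distrib_right)
      ultimately show ?thesis
        by (simp only: summand sum.distrib sum_subtractf T_def[of u v])
    qed
    also have "T u v = T (\<lambda>j. N j a) (\<lambda>j. N j b) - N i b * T (\<lambda>j. N j a) C - N i a * T C (\<lambda>j. N j b)"
      by (simp add: u_def[abs_def] v_def[abs_def] Tleft Tright TCC)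
    also have "T u C = T (\<lambda>j. N j a) C" by (simp add: u_def[abs_def] Tleft TCC)
    also have "T v C = T (\<lambda>j. N j b) C" by (simp add: v_def[abs_def] Tleft TCC)
    also have "T C (\<lambda>j. N j b) = - T (\<lambda>j. N j b) C" by (rule Tswap)
    finally have "(\<Sum>j\<in>I. \<Sum>k\<in>I. N' j a * X' j k * N' k b) = T (\<lambda>j. N j a) (\<lambda>j. N j b)"
      by (simp add: algebra_simps)
    then show ?thesis using P that by (simp add: T_def)
  qed
  have "skew_rep d m P I (n(i := n i + 1)) N' X'"
    unfolding skew_rep_def
  proof (intro conjI ballI allI impI)
    fix j assume j: "j \<in> I"
    show "0 \<le> (n(i := n i + 1)) j" using n[OF j] n[OF i] by simp
  next
    fix j a assume j: "j \<in> I" and a: "a < m"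
    show "grade_le ((n(i := n i + 1)) j) (N' j a)"
    proof (cases "j = i")
      case True
      have "grade_le (1 + n i) (l * N i a)" by (intro grade_le_mult l N i a)
      then show ?thesis using True by (simp add: N'_def add.commute)
    next
      case False
      have "grade_le (n j - n i + n i) (C j * N i a)" by (intro grade_le_mult C N i j a)
      then show ?thesis using False N[OF j a] by (auto simp: N'_def intro!: grade_le_diff)
    qed
  next
    fix j k assume j: "j \<in> I" and k: "k \<in> I"
    show "grade_le (int d - (n(i := n i + 1)) j - (n(i := n i + 1)) k) (X' j k)"
      using X[OF j k] y[OF j] grade_le_minus[OF y[OF k]] by (auto simp: X'_def algebra_simps)
    show "X' k j = - X' j k" using skew[OF j k] by (simp add: X'_def)
  qed (use I P' in auto)
  moreover have "generically_indep m I N'"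
  proof -
    obtain Z where Z: "finite Z" "\<And>\<alpha>. \<alpha> \<notin> Z \<Longrightarrow> inj_cols {..<m} I (\<lambda>a i. poly (N i a) \<alpha>)"
      using gen unfolding generically_indep_def by blast
    \<comment> \<open>Row \<open>i\<close> of \<open>N'\<close> vanishes at the roots of
      \<open>l\<close>, so these join the exceptional set.\<close>
    have "inj_cols {..<m} I (\<lambda>a i. poly (N' i a) \<alpha>)" if \<alpha>: "\<alpha> \<notin> Z \<union> {\<alpha>. poly l \<alpha> = 0}" for \<alpha>
      unfolding inj_cols_def
    proof (intro allI impI)
      fix c assume c: "\<forall>a\<in>{..<m}. (\<Sum>j\<in>I. poly (N' j a) \<alpha> * c j) = 0"
      define s where "s = (\<Sum>j\<in>I - {i}. poly (C j) \<alpha> * c j)"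
      \<comment> \<open>The combination of the rows of \<open>N'\<close> with coefficients
        \<open>c\<close> is the combination of the rows of \<open>N\<close> with coefficients
        \<open>c'\<close>.\<close>
      define c' where "c' = c(i := poly l \<alpha> * c i - s)"
      have "(\<Sum>j\<in>I. poly (N j a) \<alpha> * c' j) = (\<Sum>j\<in>I. poly (N' j a) \<alpha> * c j)" for a
      proof -
        have "(\<Sum>j\<in>I. poly (N' j a) \<alpha> * c j) = poly l \<alpha> * poly (N i a) \<alpha> * c i
            + (\<Sum>j\<in>I - {i}. poly (N j a) \<alpha> * c j) - poly (N i a) \<alpha> * s"
          using fin i by (simp add: sum.remove[of I i] N'_def s_def algebra_simps sum_subtractf sum_distrib_left)
        then show ?thesis
          using fin i by (simp add: sum.remove[of I i] c'_def algebra_simps)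
      qed
      then have c'0: "c' j = 0" if "j \<in> I" for j
        using Z(2)[of \<alpha>] \<alpha> c that inj_colsD[of "{..<m}" I "\<lambda>a i. poly (N i a) \<alpha>" c'] by auto
      have c0: "c j = 0" if "j \<in> I - {i}" for j using c'0[of j] that by (simp add: c'_def)
      then have "s = 0" by (simp add: s_def)
      then have "c i = 0" using c'0[OF i] \<alpha> by (auto simp: c'_def)
      then show "\<forall>j\<in>I. c j = 0" using c0 by blast
    qed
    moreover have "finite (Z \<union> {\<alpha>. poly l \<alpha> = 0})" using Z l poly_roots_finite by simp
    ultimately show ?thesis unfolding generically_indep_def by blast
  qed
  ultimately show ?thesis by blast
qed

text \<open>At infinity each entry is read at its own grade, so this concerns the coefficients of
  degree \<open>d - n i - n j\<close>, with 0 in place of those of negative degree.\<close>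

definition nonsingular_at :: "nat \<Rightarrow> nat set \<Rightarrow> (nat \<Rightarrow> int) \<Rightarrow> (nat \<Rightarrow> nat \<Rightarrow> complex poly) \<Rightarrow> complex option \<Rightarrow> bool" where
  "nonsingular_at d I n X x \<longleftrightarrow> inj_cols I I (\<lambda>i j. grade_eval (int d - n i - n j) x (X i j))"

text \<open>A kernel vector at \<open>x\<close> is lifted to a polynomial vector \<open>C\<close>
  whose entry \<open>j\<close> has grade \<open>n j - n i\<close>; minimality of \<open>n i\<close>
  on the support makes this nonnegative. Then \<open>X C\<close> vanishes at \<open>x\<close>, and
  dividing it by the local parameter gives the \<open>y\<close> of
  \<open>skew_rep_transform\<close>.\<close>

lemma skew_rep_reduce_singular:
  assumes rep: "skew_rep d m P I n N X" and gen: "generically_indep m I N"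
    and sing: "\<not> nonsingular_at d I n X x"
  obtains i N' X' where "i \<in> I" "skew_rep d m P I (n(i := n i + 1)) N' X'" "generically_indep m I N'"
proof -
  have fin: "finite I" using rep finite_subset unfolding skew_rep_def by blast
  have X: "\<And>j k. j \<in> I \<Longrightarrow> k \<in> I \<Longrightarrow> grade_le (int d - n j - n k) (X j k)"
    using rep unfolding skew_rep_def by blast
  obtain c0 j0 where c0: "\<And>k. k \<in> I \<Longrightarrow> (\<Sum>j\<in>I. grade_eval (int d - n k - n j) x (X k j) * c0 j) = 0"
    and j0: "j0 \<in> I" "c0 j0 \<noteq> 0"
    using sing unfolding nonsingular_at_def inj_cols_def by blast
  define S where "S = {j \<in> I. c0 j \<noteq> 0}"
  have "finite S" "S \<noteq> {}" using fin j0 by (auto simp: S_def)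
  then obtain i where i: "i \<in> S" and min: "\<And>j. j \<in> S \<Longrightarrow> n i \<le> n j"
    using arg_min_if_finite[of S n] by (metis not_le)
  have iI: "i \<in> I" "c0 i \<noteq> 0" using i by (auto simp: S_def)
  \<comment> \<open>Scaling to \<open>c i = 1\<close> makes the lift at \<open>i\<close> the
    constant 1.\<close>
  define c where "c j = c0 j / c0 i" for j
  have c: "(\<Sum>j\<in>I. grade_eval (int d - n k - n j) x (X k j) * c j) = 0" if "k \<in> I" for k
    using c0[OF that] by (simp add: c_def sum_divide_distrib[symmetric])
  \<comment> \<open>Off the support \<open>n j - n i\<close> may be negative, and then only the zero
    polynomial has that grade.\<close>
  define C where "C j = (if c j = 0 then 0 else grade_lift (n j - n i) x (c j))" for j
  have Cg: "grade_le (n j - n i) (C j)" and Ce: "grade_eval (n j - n i) x (C j) = c j" if "j \<in> I" for j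
    using grade_lift[of "n j - n i" x "c j"] min[of j] that by (auto simp: C_def S_def c_def)
  have Ci: "C i = 1" using iI by (simp add: C_def c_def grade_lift_0_1)
  have "\<exists>q. grade_le (int d - n k - n i - 1) q \<and> (\<Sum>j\<in>I. X k j * C j) = local_parameter x * q" if k: "k \<in> I" for k
  proof -
    \<comment> \<open>The grade of \<open>X k j * C j\<close> does not depend on \<open>j\<close>,
      so the sum is again a form.\<close>
    have eq: "int d - n k - n i = (int d - n k - n j) + (n j - n i)" for j by simp
    have "grade_le (int d - n k - n i) (\<Sum>j\<in>I. X k j * C j)"
    proof (rule grade_le_sum)
      fix j assume j: "j \<in> I"
      show "grade_le (int d - n k - n i) (X k j * C j)"
        by (subst eq[of j]) (intro grade_le_mult X Cg k j)
    qed
    moreover have "grade_eval (int d - n k - n i) x (\<Sum>j\<in>I. X k j * C j) = 0"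
    proof -
      have "grade_eval (int d - n k - n i) x (\<Sum>j\<in>I. X k j * C j)
          = (\<Sum>j\<in>I. grade_eval (int d - n k - n j) x (X k j) * c j)"
        unfolding grade_eval_sum
      proof (intro sum.cong refl)
        fix j assume j: "j \<in> I"
        show "grade_eval (int d - n k - n i) x (X k j * C j) = grade_eval (int d - n k - n j) x (X k j) * c j"
          by (subst eq[of j], subst grade_eval_mult[OF X[OF k j] Cg[OF j]]) (simp add: Ce j)
      qed
      then show ?thesis using c k by simp
    qed
    ultimately show ?thesis by (rule grade_eval_eq_0_imp_factor) blast
  qed
  then have "\<forall>k\<in>I. \<exists>q. grade_le (int d - n k - n i - 1) q \<and> (\<Sum>j\<in>I. X k j * C j) = local_parameter x * q"
    by (rule ballI)
  from bchoice[OF this] obtain y where "\<forall>k\<in>I. grade_le (int d - n k - n i - 1) (y k) \<and>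
      (\<Sum>j\<in>I. X k j * C j) = local_parameter x * y k" ..
  then have y: "\<And>k. k \<in> I \<Longrightarrow> grade_le (int d - n k - n i - 1) (y k)"
    "\<And>k. k \<in> I \<Longrightarrow> (\<Sum>j\<in>I. X k j * C j) = local_parameter x * y k"
    by blast+
  have "\<exists>N' X'. skew_rep d m P I (n(i := n i + 1)) N' X' \<and> generically_indep m I N'"
    by (rule skew_rep_transform[OF rep gen iI(1) Cg Ci y local_parameter_nonzero grade_le_local_parameter])
  then show ?thesis using that iI by blast
qed

lemma inj_cols_subset:
  assumes "inj_cols R J M" "J' \<subseteq> J" "finite J"
  shows "inj_cols R J' M"
  unfolding inj_cols_def
proof (intro allI impI)
  fix c assume c: "\<forall>r\<in>R. (\<Sum>j\<in>J'. M r j * c j) = 0"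
  define c' where "c' j = (if j \<in> J' then c j else 0)" for j
  have "(\<Sum>j\<in>J. M r j * c' j) = (\<Sum>j\<in>J'. M r j * c j)" for r
    using assms by (intro sum.mono_neutral_cong_right) (auto simp: c'_def)
  then have "\<forall>j\<in>J. c' j = 0" using c assms(1) unfolding inj_cols_def by simp
  then show "\<forall>j\<in>J'. c j = 0" using assms(2) by (metis c'_def subsetD)
qed

lemma skew_rep_drop:
  assumes rep: "skew_rep d m P I n N X" and i: "i \<in> I" and z: "\<And>j. j \<in> I \<Longrightarrow> X i j = 0"
  shows "skew_rep d m P (I - {i}) n N X"
proof -
  have fin: "finite I" using rep finite_subset unfolding skew_rep_def by blast
  have z': "X j i = 0" if "j \<in> I" for j
    using rep i that z unfolding skew_rep_def by (metis neg_equal_0_iff_equal)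
  have eq: "(\<Sum>k\<in>I. \<Sum>j\<in>I. N k a * X k j * N j b) = (\<Sum>k\<in>I - {i}. \<Sum>j\<in>I - {i}. N k a * X k j * N j b)" for a b
    using fin i z z' by (simp add: sum.remove[of I i])
  show ?thesis using rep unfolding skew_rep_def eq by blast
qed

lemma skew_rep_nonsingular_exists:
  assumes "skew_rep d m P I n N X" "generically_indep m I N"
  shows "\<exists>I n N X. skew_rep d m P I n N X \<and> generically_indep m I N \<and> (\<forall>x. nonsingular_at d I n X x)"
  using assms
\<comment> \<open>Raising a grade lowers the sum. The summand \<open>card I\<close> makes dropping a
  row count even when its truncated term is zero.\<close>
proof (induction "(\<Sum>i\<in>I. nat (int d + 2 - n i)) + card I" arbitrary: I n N X rule: less_induct)
  case (less I n N X)
  have fin: "finite I" using less.prems finite_subset unfolding skew_rep_def by blast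
  show ?case
  proof (cases "\<exists>i\<in>I. \<forall>j\<in>I. X i j = 0")
    case True
    then obtain i where i: "i \<in> I" "\<And>j. j \<in> I \<Longrightarrow> X i j = 0" by blast
    have "skew_rep d m P (I - {i}) n N X" using skew_rep_drop less.prems(1) i by blast
    moreover have "generically_indep m (I - {i}) N"
      using less.prems(2) inj_cols_subset fin unfolding generically_indep_def by (metis Diff_subset)
    moreover have "(\<Sum>i\<in>I - {i}. nat (int d + 2 - n i)) + card (I - {i}) < (\<Sum>i\<in>I. nat (int d + 2 - n i)) + card I"
      using fin i(1) by (intro add_le_less_mono sum_mono2 card_Diff1_less) auto
    ultimately show ?thesis using less.hyps by blast
  next
    case nz: False
    show ?thesis
    proof (cases "\<forall>x. nonsingular_at d I n X x")
      case True then show ?thesis using less.prems by blast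
    next
      case False
      then obtain i N' X' where i: "i \<in> I" and new: "skew_rep d m P I (n(i := n i + 1)) N' X'" "generically_indep m I N'"
        using skew_rep_reduce_singular less.prems by blast
      obtain j where j: "j \<in> I" "X i j \<noteq> 0" using nz i by blast
      have "grade_le (int d - n i - n j) (X i j)" "0 \<le> n j"
        using less.prems(1) i j(1) unfolding skew_rep_def by blast+
      then have "0 \<le> int d - n i - n j" "0 \<le> n j" using j(2) by (auto simp: grade_le_iff_degree)
      \<comment> \<open>A nonzero \<open>X i j\<close> and \<open>0 \<le> n j\<close> force
        \<open>n i \<le> d\<close>, so the truncated difference is still positive and really
        drops.\<close>
      then have "nat (int d + 2 - (n i + 1)) < nat (int d + 2 - n i)" by linarith
      then have "(\<Sum>k\<in>I. nat (int d + 2 - (n(i := n i + 1)) k)) < (\<Sum>k\<in>I. nat (int d + 2 - n k))"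
        using fin i by (intro sum_strict_mono_ex1) auto
      then show ?thesis by (intro less.hyps[OF _ new]) simp
    qed
  qed
qed

text \<open>The new rows of \<open>N\<close> are zero, which leaves \<open>P\<close> alone. With row
  grades 0 and \<open>d\<close> the entries between \<open>p\<close> and \<open>q\<close> have grade
  0, so 1 and -1 are nonzero at every point, infinity included. Zero rows spoil the independence of
  \<open>N\<close>; the perturbation restores it.\<close>

lemma skew_rep_pad:
  assumes rep: "skew_rep d m P I n N X" and ns: "\<forall>x. nonsingular_at d I n X x"
    and card: "card I + 2 \<le> m"
  shows "\<exists>I' n N X. skew_rep d m P I' n N X \<and> (\<forall>x. nonsingular_at d I' n X x) \<and> card I' = card I + 2"
proof -
  have I: "I \<subseteq> {..<m}" and n: "\<And>j. j \<in> I \<Longrightarrow> 0 \<le> n j"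
    and N: "\<And>j a. j \<in> I \<Longrightarrow> a < m \<Longrightarrow> grade_le (n j) (N j a)"
    and X: "\<And>j k. j \<in> I \<Longrightarrow> k \<in> I \<Longrightarrow> grade_le (int d - n j - n k) (X j k)"
    and skew: "\<And>j k. j \<in> I \<Longrightarrow> k \<in> I \<Longrightarrow> X k j = - X j k"
    and P: "\<And>a b. a < m \<Longrightarrow> b < m \<Longrightarrow> P a b = (\<Sum>i\<in>I. \<Sum>j\<in>I. N i a * X i j * N j b)"
    using rep unfolding skew_rep_def by blast+
  have fin: "finite I" using I finite_subset by blast
  have "card ({..<m} - I) = m - card I" using I fin by (simp add: card_Diff_subset)
  then have "card ({..<m} - I) \<ge> 2" using card by simp
  then obtain T where T: "T \<subseteq> {..<m} - I" "card T = 2" by (meson obtain_subset_with_card_n)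
  then obtain p q where pq: "T = {p, q}" "p \<noteq> q" by (meson card_2_iff)
  have p: "p < m" "p \<notin> I" and q: "q < m" "q \<notin> I" using T pq by auto
  let ?I = "insert p (insert q I)"
  define n' where "n' = n(p := 0, q := int d)"
  define N' where "N' i a = (if i \<in> I then N i a else 0)" for i a
  define X' where "X' i j = (if i \<in> I \<and> j \<in> I then X i j else if i = p \<and> j = q then 1
      else if i = q \<and> j = p then - 1 else 0)" for i j
  have nI: "n' i = n i" if "i \<in> I" for i using that p q by (auto simp: n'_def)
  have [simp]: "n' p = 0" "n' q = int d" using pq by (auto simp: n'_def)
  have XI: "X' i j = X i j" if "i \<in> I" "j \<in> I" for i j using that by (simp add: X'_def)
  have [simp]: "X' p j = 0" "X' q j = 0" "X' j p = 0" "X' j q = 0" if "j \<in> I" for j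
    using that p q by (auto simp: X'_def)
  have [simp]: "X' p p = 0" "X' q q = 0" "X' p q = 1" "X' q p = - 1"
    using p q pq by (auto simp: X'_def)
  have g1: "grade_le 0 1" "grade_le 0 (- 1)" by (auto simp: grade_le_iff_degree)
  have "skew_rep d m P ?I n' N' X'"
    unfolding skew_rep_def
  proof (intro conjI ballI allI impI)
    fix i assume "i \<in> ?I"
    then show "0 \<le> n' i" using n nI by auto
  next
    fix i a assume "i \<in> ?I" "a < m"
    then show "grade_le (n' i) (N' i a)"
      using N nI p q by (auto simp: N'_def)
  next
    fix i j assume "i \<in> ?I" "j \<in> ?I"
    then show "grade_le (int d - n' i - n' j) (X' i j)" "X' j i = - X' i j"
      by (auto simp: nI XI g1 X intro: skew)
  next
    fix a b assume ab: "a < m" "b < m"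
    have "(\<Sum>i\<in>?I. \<Sum>j\<in>?I. N' i a * X' i j * N' j b) = (\<Sum>i\<in>I. \<Sum>j\<in>I. N' i a * X' i j * N' j b)"
      using fin p q pq by (simp add: N'_def)
    also have "\<dots> = (\<Sum>i\<in>I. \<Sum>j\<in>I. N i a * X i j * N j b)"
      by (intro sum.cong refl) (simp add: N'_def XI)
    finally show "P a b = (\<Sum>i\<in>?I. \<Sum>j\<in>?I. N' i a * X' i j * N' j b)"
      using P ab by simp
  qed (use I p q in auto)
  moreover have "nonsingular_at d ?I n' X' x" for x
    unfolding nonsingular_at_def inj_cols_def
  proof (intro allI impI)
    fix c assume c: "\<forall>r\<in>?I. (\<Sum>j\<in>?I. grade_eval (int d - n' r - n' j) x (X' r j) * c j) = 0"
    have e1: "grade_eval 0 x 1 = 1" "grade_eval 0 x (- 1) = - 1" by (auto simp: grade_eval_def split: option.splits)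
    have split: "(\<Sum>j\<in>?I. f j) = f p + f q + (\<Sum>j\<in>I. f j)" for f :: "nat \<Rightarrow> complex"
      using fin p q pq by (simp add: add_ac)
    have "c q = 0" using bspec[OF c, of p] by (simp add: split e1)
    moreover have "c p = 0" using bspec[OF c, of q] by (simp add: split e1)
    moreover have "c j = 0" if "j \<in> I" for j
    proof (rule inj_colsD[OF ns[THEN spec, unfolded nonsingular_at_def, of x] _ that])
      fix r assume r: "r \<in> I"
      have "(\<Sum>j\<in>I. grade_eval (int d - n' r - n' j) x (X' r j) * c j) = 0"
        using bspec[OF c, of r] r by (simp add: split)
      then show "(\<Sum>j\<in>I. grade_eval (int d - n r - n j) x (X r j) * c j) = 0"
        using r by (simp add: nI XI)
    qed
    ultimately show "\<forall>j\<in>?I. c j = 0" by blast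
  qed
  moreover have "card ?I = card I + 2" using fin p q pq by simp
  ultimately show ?thesis by blast
qed

lemma skew_rep_pad_to:
  assumes "skew_rep d m P I n N X" "\<forall>x. nonsingular_at d I n X x" "card I + 2 * k \<le> m"
  shows "\<exists>I' n N X. skew_rep d m P I' n N X \<and> (\<forall>x. nonsingular_at d I' n X x) \<and> card I' = card I + 2 * k"
  using assms
proof (induction k arbitrary: I n N X)
  case 0 then show ?case by auto
next
  case (Suc k)
  obtain I' n' N' X' where new: "skew_rep d m P I' n' N' X'" "\<forall>x. nonsingular_at d I' n' X' x" "card I' = card I + 2"
    using skew_rep_pad[OF Suc.prems(1,2)] Suc.prems(3) by auto
  then show ?case using Suc.IH[OF new(1,2)] Suc.prems(3) by auto
qed

section \<open>Perturbation to full rank at every point\<close>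

definition in_col_span :: "nat \<Rightarrow> nat set \<Rightarrow> (nat \<Rightarrow> nat \<Rightarrow> complex) \<Rightarrow> (nat \<Rightarrow> complex) \<Rightarrow> bool" where
  "in_col_span m I M v \<longleftrightarrow> (\<exists>c. \<forall>a<m. v a = (\<Sum>i\<in>I. M a i * c i))"

lemma in_col_span_cong:
  assumes "\<And>a i. a < m \<Longrightarrow> i \<in> I \<Longrightarrow> M a i = M' a i" "\<And>a. a < m \<Longrightarrow> v a = v' a"
  shows "in_col_span m I M v \<longleftrightarrow> in_col_span m I M' v'"
  using assms by (simp add: in_col_span_def cong: sum.cong)

lemma in_col_span_lincomb:
  assumes "in_col_span m I M v" "in_col_span m I M w"
  shows "in_col_span m I M (\<lambda>a. s * v a + t * w a)"
proof -
  obtain c e where c: "\<forall>a<m. v a = (\<Sum>i\<in>I. M a i * c i)" and e: "\<forall>a<m. w a = (\<Sum>i\<in>I. M a i * e i)"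
    using assms unfolding in_col_span_def by blast
  have "\<forall>a<m. s * v a + t * w a = (\<Sum>i\<in>I. M a i * (s * c i + t * e i))"
    using c e by (simp add: sum_distrib_left algebra_simps sum.distrib)
  then show ?thesis unfolding in_col_span_def by (rule exI[of _ "\<lambda>i. s * c i + t * e i"])
qed

lemma in_col_span_scaled:
  assumes "in_col_span m I M (\<lambda>a. s * v a)" "s \<noteq> 0"
  shows "in_col_span m I M v"
  using in_col_span_lincomb[OF assms(1) assms(1), of "1 / s" 0] assms(2) by simp

text \<open>Two distinct bad parameters would put first \<open>w\<close> and then \<open>v\<close>
  into the span, so there is at most one.\<close>

lemma finite_in_col_span_line:
  assumes "\<not> (in_col_span m I M v \<and> in_col_span m I M w)"
  shows "finite {t. in_col_span m I M (\<lambda>a. v a + t * w a)}"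
proof -
  let ?B = "{t. in_col_span m I M (\<lambda>a. v a + t * w a)}"
  have "s = t" if s: "s \<in> ?B" and t: "t \<in> ?B" for s t
  proof (rule ccontr)
    assume "s \<noteq> t"
    have "in_col_span m I M (\<lambda>a. (s - t) * w a)"
      using in_col_span_lincomb[of m I M "\<lambda>a. v a + s * w a" "\<lambda>a. v a + t * w a" 1 "- 1"] s t
      by (simp add: algebra_simps)
    then have w: "in_col_span m I M w" using \<open>s \<noteq> t\<close> in_col_span_scaled by simp
    have "in_col_span m I M v"
      using in_col_span_lincomb[of m I M "\<lambda>a. v a + s * w a" w 1 "- s"] s w
      by (simp add: algebra_simps)
    then show False using w assms by blast
  qed
  then have sub: "?B \<subseteq> {t}" if "t \<in> ?B" for t using that by blast
  show ?thesis
  proof (cases "?B = {}")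
    case False
    then obtain t where "t \<in> ?B" by blast
    then show ?thesis by (rule finite_subset[OF sub]) simp
  qed simp
qed

lemma inj_cols_insertI:
  assumes inj: "inj_cols {..<m} I M" and fin: "finite I" and p: "p \<notin> I"
    and span: "\<not> in_col_span m I M (\<lambda>a. M a p)"
  shows "inj_cols {..<m} (insert p I) M"
  unfolding inj_cols_def
proof (intro allI impI)
  fix c assume "\<forall>a\<in>{..<m}. (\<Sum>i\<in>insert p I. M a i * c i) = 0"
  then have c: "M a p * c p + (\<Sum>i\<in>I. M a i * c i) = 0" if "a < m" for a using that fin p by simp
  have cp: "c p = 0"
  proof (rule ccontr)
    assume nz: "c p \<noteq> 0"
    have "M a p = (\<Sum>i\<in>I. M a i * (- c i / c p))" if "a < m" for a
    proof -
      have "M a p = - (\<Sum>i\<in>I. M a i * c i) / c p"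
        using c[OF that] nz by (simp add: field_simps eq_neg_iff_add_eq_0)
      then show ?thesis by (simp add: sum_divide_distrib sum_negf)
    qed
    then have "in_col_span m I M (\<lambda>a. M a p)"
      unfolding in_col_span_def by (intro exI[of _ "\<lambda>i. - c i / c p"] allI impI)
    then show False using span by contradiction
  qed
  then have "\<forall>i\<in>I. c i = 0" using c inj unfolding inj_cols_def by simp
  then show "\<forall>j\<in>insert p I. c j = 0" using cp by simp
qed

lemma inj_cols_insert_not_span:
  assumes inj: "inj_cols {..<m} (insert p I) M" and fin: "finite I" and p: "p \<notin> I"
  shows "\<not> in_col_span m I M (\<lambda>a. M a p)"
proof
  assume "in_col_span m I M (\<lambda>a. M a p)"
  then obtain c where c: "\<forall>a<m. M a p = (\<Sum>i\<in>I. M a i * c i)" unfolding in_col_span_def by blast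
  define e where "e = c(p := - 1)"
  have "(\<Sum>i\<in>I. M a i * e i) = (\<Sum>i\<in>I. M a i * c i)" for a
    using p by (intro sum.cong) (auto simp: e_def)
  then have "(\<Sum>i\<in>insert p I. M a i * e i) = 0" if "a \<in> {..<m}" for a
    using that c fin p by (simp add: e_def)
  then have "e p = 0" using inj unfolding inj_cols_def by blast
  then show False by (simp add: e_def)
qed

text \<open>The point of the moment curve with a generic parameter avoids finitely many hyperplanes.\<close>

lemma exists_vector_off_spans:
  fixes M :: "'x \<Rightarrow> nat \<Rightarrow> nat \<Rightarrow> complex"
  assumes F: "finite F" and I: "\<And>x. x \<in> F \<Longrightarrow> finite (I x) \<and> card (I x) < m"
  obtains w where "\<And>x. x \<in> F \<Longrightarrow> \<not> in_col_span m (I x) (M x) w"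
proof -
  \<comment> \<open>Fewer than \<open>m\<close> columns lie in a hyperplane; \<open>h\<close> is a
    normal vector of it.\<close>
  have "\<exists>h. (\<forall>i\<in>I x. (\<Sum>a<m. M x a i * h a) = 0) \<and> (\<exists>a<m. h a \<noteq> 0)" if "x \<in> F" for x
    using not_inj_cols_if_card_less[of "I x" "{..<m}" "\<lambda>i a. M x a i"] I[OF that]
    unfolding inj_cols_def by auto
  then have "\<forall>x\<in>F. \<exists>h. (\<forall>i\<in>I x. (\<Sum>a<m. M x a i * h a) = 0) \<and> (\<exists>a<m. h a \<noteq> 0)" by (rule ballI)
  from bchoice[OF this] obtain h where
    h: "\<forall>x\<in>F. (\<forall>i\<in>I x. (\<Sum>a<m. M x a i * h x a) = 0) \<and> (\<exists>a<m. h x a \<noteq> 0)" ..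
  \<comment> \<open>\<open>poly (q x) s\<close> is the pairing of \<open>h x\<close> with the moment
    vector \<open>(1, s, s\<^sup>2, ...)\<close>.\<close>
  define q where "q x = (\<Sum>a<m. monom (h x a) a)" for x
  have "q x \<noteq> 0" if x: "x \<in> F" for x
  proof -
    obtain a where a: "a < m" "h x a \<noteq> 0" using h x by blast
    then have "coeff (q x) a = h x a" by (simp add: q_def coeff_sum coeff_monom)
    then show ?thesis using a by auto
  qed
  then have "finite (\<Union>x\<in>F. {s. poly (q x) s = 0})" using F poly_roots_finite by auto
  then obtain s where s: "s \<notin> (\<Union>x\<in>F. {s. poly (q x) s = 0})"
    using ex_new_if_finite infinite_UNIV_char_0 by blast
  have "\<not> in_col_span m (I x) (M x) (\<lambda>a. s ^ a)" if x: "x \<in> F" for x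
  proof
    assume "in_col_span m (I x) (M x) (\<lambda>a. s ^ a)"
    then obtain c where c: "\<forall>a<m. s ^ a = (\<Sum>i\<in>I x. M x a i * c i)" unfolding in_col_span_def by blast
    have "poly (q x) s = (\<Sum>a<m. h x a * s ^ a)" by (simp add: q_def poly_sum poly_monom)
    also have "\<dots> = (\<Sum>a<m. \<Sum>i\<in>I x. c i * (M x a i * h x a))"
      using c by (intro sum.cong) (auto simp: sum_distrib_left mult_ac)
    also have "\<dots> = (\<Sum>i\<in>I x. c i * (\<Sum>a<m. M x a i * h x a))"
      by (subst sum.swap) (simp add: sum_distrib_left)
    also have "\<dots> = 0" using h x by simp
    finally show False using s x by blast
  qed
  then show ?thesis using that by blast
qed

section \<open>Minors at a point and small perturbations\<close>

lemma poly_det: "poly (det A) \<alpha> = det (map_mat (\<lambda>p. poly p \<alpha>) A)" for A :: "'a::comm_ring_1 poly mat"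
proof -
  interpret comm_ring_hom "\<lambda>p::'a poly. poly p \<alpha>" by unfold_locales auto
  show ?thesis by simp
qed

lemma map_mat_submatrix:
  assumes "A \<in> carrier_mat m n" "R \<subseteq> {..<m}" "J \<subseteq> {..<n}"
  shows "map_mat f (submatrix A R J) = submatrix (map_mat f A) R J"
proof (rule eq_matI)
  let ?S = "submatrix A R J" and ?S' = "submatrix (map_mat f A) R J"
  have A': "map_mat f A \<in> carrier_mat m n" using assms by simp
  have S: "?S \<in> carrier_mat (card R) (card J)" "?S' \<in> carrier_mat (card R) (card J)"
    using submatrix_carrier_subset assms A' by blast+
  fix i j assume "i < dim_row ?S'" "j < dim_col ?S'"
  then have ij: "i < card R" "j < card J" using S by auto
  then have "pick R i < m" "pick J j < n" using assms pick_in_set_le by blast+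
  then show "map_mat f ?S $$ (i, j) = ?S' $$ (i, j)"
    using ij S assms by (simp add: submatrix_index_subset[OF assms] submatrix_index_subset[OF A' assms(2,3)])
qed (use assms in \<open>simp_all add: dim_submatrix\<close>)

text \<open>A minor on the columns \<open>I\<close> that is nonzero at \<alpha> is a nonzero
  polynomial, and dependence can occur only at its roots.\<close>

lemma finite_dependent_points:
  fixes N :: "nat \<Rightarrow> nat \<Rightarrow> complex poly"
  assumes I: "I \<subseteq> {..<m}" and inj: "inj_cols {..<m} I (\<lambda>a i. poly (N i a) \<alpha>)"
  shows "finite {\<beta>. \<not> inj_cols {..<m} I (\<lambda>a i. poly (N i a) \<beta>)}"
proof -
  have fin: "finite I" by (rule finite_subset[OF I]) simp
  obtain R where R: "R \<subseteq> {..<m}" "card R = card I" "inj_cols R I (\<lambda>a i. poly (N i a) \<alpha>)"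
    by (rule inj_cols_select_rows[OF finite_lessThan fin inj])
  define A where "A = mat m m (\<lambda>(a, i). N i a)"
  have A: "A \<in> carrier_mat m m" by (simp add: A_def)
  have eq: "poly (det (submatrix A R I)) \<beta> \<noteq> 0 \<longleftrightarrow> inj_cols R I (\<lambda>a i. poly (N i a) \<beta>)" for \<beta>
  proof -
    have "poly (det (submatrix A R I)) \<beta> \<noteq> 0 \<longleftrightarrow>
        inj_cols R I (\<lambda>i j. map_mat (\<lambda>p. poly p \<beta>) A $$ (i, j))"
      unfolding poly_det map_mat_submatrix[OF A R(1) I]
      by (rule det_submatrix_neq_0_iff) (use A R I in auto)
    also have "\<dots> \<longleftrightarrow> inj_cols R I (\<lambda>a i. poly (N i a) \<beta>)"
      using R(1) I by (intro inj_cols_cong) (auto simp: A_def subset_iff)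
    finally show ?thesis .
  qed
  then have "det (submatrix A R I) \<noteq> 0" using R(3) by (metis poly_0)
  then have "finite {\<beta>. poly (det (submatrix A R I)) \<beta> = 0}" by (rule poly_roots_finite)
  moreover have "{\<beta>. \<not> inj_cols {..<m} I (\<lambda>a i. poly (N i a) \<beta>)} \<subseteq> {\<beta>. poly (det (submatrix A R I)) \<beta> = 0}"
    using eq inj_cols_mono R(1) by blast
  ultimately show ?thesis by (rule rev_finite_subset)
qed

text \<open>A disc is uncountable, so it contains a parameter outside the finite set
  \<open>B\<close>.\<close>

lemma small_perturbation:
  fixes v w :: "nat \<Rightarrow> complex poly"
  assumes "finite B" "\<delta> > 0"
  obtains t where "t \<notin> B" "\<And>a l. a < m \<Longrightarrow> cmod (coeff (v a + Polynomial.smult t (w a)) l - coeff (v a) l) < \<delta>"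
proof -
  \<comment> \<open>A common bound for the coefficients of all \<open>w a\<close>; the summand 1
    makes it a legitimate divisor.\<close>
  define K where "K = 1 + (\<Sum>a<m. \<Sum>l\<le>degree (w a). cmod (coeff (w a) l))"
  have K: "K > 0" unfolding K_def by (intro add_pos_nonneg sum_nonneg) auto
  have wK: "cmod (coeff (w a) l) \<le> K" if a: "a < m" for a l
  proof (cases "l \<le> degree (w a)")
    case True
    have "cmod (coeff (w a) l) \<le> (\<Sum>l\<le>degree (w a). cmod (coeff (w a) l))"
      using True by (intro member_le_sum) auto
    also have "\<dots> \<le> (\<Sum>a<m. \<Sum>l\<le>degree (w a). cmod (coeff (w a) l))"
      using a by (intro member_le_sum[of a "{..<m}" "\<lambda>a. \<Sum>l\<le>degree (w a). cmod (coeff (w a) l)"])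
        (auto intro: sum_nonneg)
    finally show ?thesis by (simp add: K_def)
  next
    case False
    then show ?thesis using K by (simp add: coeff_eq_0)
  qed
  have "uncountable (ball (0::complex) (\<delta> / K))" using assms K by (intro uncountable_ball) simp
  then have "\<not> ball 0 (\<delta> / K) \<subseteq> B" using assms(1) countable_finite countable_subset by blast
  then obtain t where "t \<notin> B" "t \<in> ball 0 (\<delta> / K)" by blast
  then have t: "t \<notin> B" "cmod t < \<delta> / K" by simp_all
  have "cmod (coeff (v a + Polynomial.smult t (w a)) l - coeff (v a) l) < \<delta>" if "a < m" for a l
  proof -
    have "cmod (coeff (v a + Polynomial.smult t (w a)) l - coeff (v a) l) = cmod t * cmod (coeff (w a) l)"
      by (simp add: norm_mult)
    also have "\<dots> \<le> cmod t * K" using wK[OF that] by (intro mult_left_mono) auto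
    also have "\<dots> < \<delta>" using t K by (simp add: pos_less_divide_eq)
    finally show ?thesis .
  qed
  then show ?thesis using that t by blast
qed

lemma grade_le_smult: "grade_le n p \<Longrightarrow> grade_le n (Polynomial.smult c p)"
  by (simp add: grade_le_def)

lemma grade_eval_smult: "grade_eval n x (Polynomial.smult c p) = c * grade_eval n x p"
  by (simp add: grade_eval_def split: option.splits)

text \<open>Infinitely many points have to be avoided with one parameter. A constant shift
  \<open>v1\<close> of \<open>v\<close> is off the span at all but finitely many finite points. Then
  \<open>w\<close> is chosen off the span at those points and at infinity, and off the span enlarged
  by \<open>v1\<close> at 0. Hence the old rows, \<open>v1\<close> and \<open>w\<close> are
  independent at all but finitely many finite points, where no \<open>v1 + t w\<close> lies in the
  span. At each remaining point, infinity included, \<open>v1\<close> or \<open>w\<close> is off the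
  span, so at most one \<open>t\<close> is bad.\<close>

lemma perturb_row:
  assumes I: "I \<subseteq> {..<m}" and p: "p < m" "p \<notin> I" and card: "card I + 2 \<le> m"
    and inj: "\<And>x. inj_cols {..<m} I (\<lambda>a i. grade_eval (n i) x (N i a))"
    and k: "0 \<le> k" and v: "\<And>a. a < m \<Longrightarrow> grade_le k (v a)" and \<delta>: "\<delta> > 0"
  obtains v' where "\<And>a. a < m \<Longrightarrow> grade_le k (v' a)"
    "\<And>a l. a < m \<Longrightarrow> cmod (coeff (v' a) l - coeff (v a) l) < \<delta>"
    "\<And>x. \<not> in_col_span m I (\<lambda>a i. grade_eval (n i) x (N i a)) (\<lambda>a. grade_eval k x (v' a))"
proof -
  have fin: "finite I" by (rule finite_subset[OF I]) simp
  let ?M = "\<lambda>x a i. grade_eval (n i) x (N i a)"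
  let ?span = "\<lambda>x. in_col_span m I (?M x)"
  \<comment> \<open>A constant direction off the span at 0. The shift along it uses half of
    \<delta>; the other half is kept for the shift along \<open>w\<close>.\<close>
  obtain w0 where w0: "\<not> ?span (Some 0) w0"
    using exists_vector_off_spans[of "{()}" "\<lambda>_. I" m "\<lambda>_. ?M (Some 0)"] fin card by auto
  have "finite {t. ?span (Some 0) (\<lambda>a. poly (v a) 0 + t * w0 a)}"
    using w0 by (intro finite_in_col_span_line) simp
  from small_perturbation[OF this, of "\<delta> / 2" m v "\<lambda>a. [:w0 a:]"] obtain t0
    where t0: "\<not> ?span (Some 0) (\<lambda>a. poly (v a) 0 + t0 * w0 a)"
      and close0: "\<And>a l. a < m \<Longrightarrow> cmod (coeff (v a + Polynomial.smult t0 [:w0 a:]) l - coeff (v a) l) < \<delta> / 2"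
    using \<delta> by auto
  define v1 where "v1 a = v a + Polynomial.smult t0 [:w0 a:]" for a
  have v1: "grade_le k (v1 a)" if "a < m" for a
    unfolding v1_def by (intro grade_le_add grade_le_smult grade_le_const v that k)
  define N1 where "N1 = N(p := v1)"
  define n1 where "n1 = n(p := k)"
  let ?M1 = "\<lambda>x a i. grade_eval (n1 i) x (N1 i a)"
  let ?I1 = "insert p I"
  have I1: "?I1 \<subseteq> {..<m}" using I p by simp
  have M1I: "?M1 x a i = ?M x a i" if "i \<in> I" for x a i using that p by (auto simp: n1_def N1_def)
  have M1p: "?M1 x a p = grade_eval k x (v1 a)" for x a by (simp add: n1_def N1_def)
  have span1: "in_col_span m I (?M1 x) u \<longleftrightarrow> ?span x u" for x u
    by (intro in_col_span_cong) (auto simp: M1I)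
  have inj1I: "inj_cols {..<m} I (?M1 x)" for x
    using inj[of x] inj_cols_cong[of "{..<m}" I "?M1 x" "?M x"] M1I by blast
  have inj10: "inj_cols {..<m} ?I1 (?M1 (Some 0))"
  proof (rule inj_cols_insertI[OF inj1I fin p(2)])
    show "\<not> in_col_span m I (?M1 (Some 0)) (\<lambda>a. ?M1 (Some 0) a p)"
      using t0 unfolding span1 M1p by (simp add: v1_def)
  qed
  define Z1 where "Z1 = {\<beta>. \<not> inj_cols {..<m} ?I1 (?M1 (Some \<beta>))}"
  have Z1: "finite Z1"
    using finite_dependent_points[OF I1, of N1 0] inj10 unfolding Z1_def by simp
  have v1_span: "\<not> ?span (Some \<gamma>) (\<lambda>a. grade_eval k (Some \<gamma>) (v1 a))" if "\<gamma> \<notin> Z1" for \<gamma>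
    using inj_cols_insert_not_span[OF _ fin p(2), of m "?M1 (Some \<gamma>)"] that
    unfolding span1 M1p Z1_def by blast
  obtain \<beta> where \<beta>: "\<beta> \<notin> insert 0 Z1"
    using ex_new_if_finite[of "insert 0 Z1"] Z1 infinite_UNIV_char_0 by blast
  \<comment> \<open>The spans that \<open>w2\<close> must avoid: that of the rows in
    \<open>I\<close> at infinity and on \<open>Z1\<close>, and that of the rows including
    \<open>v1\<close> at 0.\<close>
  define F where "F = (\<lambda>x. (I, x)) ` insert None (Some ` Z1) \<union> {(?I1, Some (0::complex))}"
  have F: "finite F" using Z1 by (simp add: F_def)
  have "finite (fst z) \<and> card (fst z) < m" if "z \<in> F" for z
    using that fin card p by (auto simp: F_def)
  from exists_vector_off_spans[of F fst m "\<lambda>z. ?M1 (snd z)", OF F this]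
  obtain w2 where w2: "\<And>z. z \<in> F \<Longrightarrow> \<not> in_col_span m (fst z) (?M1 (snd z)) w2" by blast
  have w2None: "\<not> ?span None w2"
    by (rule w2[of "(I, None)", unfolded fst_conv snd_conv span1]) (simp add: F_def)
  have w2Z: "\<not> ?span (Some \<gamma>) w2" if "\<gamma> \<in> Z1" for \<gamma>
    by (rule w2[of "(I, Some \<gamma>)", unfolded fst_conv snd_conv span1]) (simp add: F_def that)
  have w20: "\<not> in_col_span m ?I1 (?M1 (Some 0)) w2"
    by (rule w2[of "(?I1, Some 0)", unfolded fst_conv snd_conv]) (simp add: F_def)
  \<comment> \<open>The scalar factor has grade \<open>k\<close>, value 1 at infinity and no finite
    zero other than \<beta>. So \<open>w\<close> is as far off the spans as \<open>w2\<close> at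
    infinity, at 0 and on \<open>Z1\<close>, as \<beta> is none of these points.\<close>
  define w where "w a = Polynomial.smult (w2 a) ([:- \<beta>, 1:] ^ nat k)" for a
  have w: "grade_le k (w a)" for a
    using k by (auto simp: w_def grade_le_iff_degree degree_power_eq intro!: grade_le_smult)
  define g where "g x = grade_eval k x ([:- \<beta>, 1:] ^ nat k)" for x
  have wg: "grade_eval k x (w a) = g x * w2 a" for x a by (simp add: w_def g_def grade_eval_smult)
  have g: "g None = 1" "\<gamma> \<noteq> \<beta> \<Longrightarrow> g (Some \<gamma>) \<noteq> 0" for \<gamma>
    using k by (auto simp: g_def grade_eval_def coeff_linear_power)
  have w_span: "\<not> ?span x (\<lambda>a. grade_eval k x (w a))" if "\<not> ?span x w2" "g x \<noteq> 0" for x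
    using that in_col_span_scaled unfolding wg by blast
  have "card ?I1 < m" using card fin p by simp
  \<comment> \<open>A spare index under which \<open>w\<close> is stored as one more row.\<close>
  then obtain q where q: "q < m" "q \<notin> ?I1"
    using card_mono[of ?I1 "{..<m}"] fin by (metis card_lessThan finite.insertI lessThan_iff not_le subsetI)
  define N2 where "N2 = N1(q := w)"
  define n2 where "n2 = n1(q := k)"
  let ?M2 = "\<lambda>x a i. grade_eval (n2 i) x (N2 i a)"
  let ?I2 = "insert q ?I1"
  have I2: "?I2 \<subseteq> {..<m}" using I1 q by simp
  have M2I: "?M2 x a i = ?M1 x a i" if "i \<in> ?I1" for x a i using that q by (auto simp: n2_def N2_def)
  have M2q: "?M2 x a q = grade_eval k x (w a)" for x a by (simp add: n2_def N2_def)
  have inj20: "inj_cols {..<m} ?I2 (?M2 (Some 0))"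
  proof (rule inj_cols_insertI)
    show "inj_cols {..<m} ?I1 (?M2 (Some 0))"
      using inj10 inj_cols_cong[of "{..<m}" ?I1 "?M2 (Some 0)" "?M1 (Some 0)"] M2I by blast
    have "in_col_span m ?I1 (?M2 (Some 0)) u \<longleftrightarrow> in_col_span m ?I1 (?M1 (Some 0)) u" for u
      by (intro in_col_span_cong M2I) auto
    moreover have "g (Some 0) \<noteq> 0" using g(2)[of 0] \<beta> by auto
    ultimately show "\<not> in_col_span m ?I1 (?M2 (Some 0)) (\<lambda>a. ?M2 (Some 0) a q)"
      using w20 in_col_span_scaled unfolding M2q wg by blast
  qed (use fin q in auto)
  define Z2 where "Z2 = {\<gamma>. \<not> inj_cols {..<m} ?I2 (?M2 (Some \<gamma>))}"
  have Z2: "finite Z2"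
    using finite_dependent_points[OF I2, of N2 0] inj20 unfolding Z2_def by simp
  define B where "B x = {t. ?span x (\<lambda>a. grade_eval k x (v1 a) + t * grade_eval k x (w a))}" for x
  have B: "finite (B x)" for x
    unfolding B_def
  proof (rule finite_in_col_span_line)
    show "\<not> (?span x (\<lambda>a. grade_eval k x (v1 a)) \<and> ?span x (\<lambda>a. grade_eval k x (w a)))"
    proof (cases x)
      case None
      then show ?thesis using w_span w2None g(1) by simp
    next
      case (Some \<gamma>)
      show ?thesis
      proof (cases "\<gamma> \<in> Z1")
        case True
        then have "\<gamma> \<noteq> \<beta>" using \<beta> by blast
        then show ?thesis using w_span[of x] w2Z[OF True] g(2) Some by blast
      qed (use v1_span Some in blast)
    qed
  qed
  have Bempty: "B (Some \<gamma>) = {}" if "\<gamma> \<notin> Z2" for \<gamma>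
  proof -
    have "False" if "t \<in> B (Some \<gamma>)" for t
    proof -
      let ?x = "Some \<gamma>"
      obtain c where c: "\<forall>a<m. grade_eval k ?x (v1 a) + t * grade_eval k ?x (w a) = (\<Sum>i\<in>I. ?M ?x a i * c i)"
        using \<open>t \<in> B ?x\<close> unfolding B_def in_col_span_def by blast
      \<comment> \<open>A bad \<open>t\<close> is a linear relation among the rows \<open>I\<close>,
        \<open>v1\<close> and \<open>w\<close>, which is impossible outside
        \<open>Z2\<close>.\<close>
      define e where "e = c(p := - 1, q := - t)"
      have pq: "p \<noteq> q" "q \<notin> I" using q by auto
      have "(\<Sum>i\<in>I. ?M2 ?x a i * e i) = (\<Sum>i\<in>I. ?M ?x a i * c i)" for a
      proof (intro sum.cong refl)
        fix i assume i: "i \<in> I"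
        have "?M2 ?x a i = ?M ?x a i" using M2I[of i ?x a] M1I[of i ?x a] i by simp
        moreover have "e i = c i" using i p q by (auto simp: e_def)
        ultimately show "?M2 ?x a i * e i = ?M ?x a i * c i" by simp
      qed
      then have "(\<Sum>i\<in>?I2. ?M2 ?x a i * e i) = 0" if "a \<in> {..<m}" for a
        using that c fin p pq M2q[of ?x a] M2I[of p ?x a] M1p[of ?x a] by (simp add: e_def) (simp add: algebra_simps)
      then have "e p = 0" using \<open>\<gamma> \<notin> Z2\<close> unfolding Z2_def inj_cols_def by blast
      then show False using pq by (simp add: e_def)
    qed
    then show ?thesis by blast
  qed
  have "finite (\<Union>x\<in>insert None (Some ` Z2). B x)" using Z2 B by blast
  from small_perturbation[OF this, of "\<delta> / 2" m v1 w] obtain t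
    where t: "t \<notin> (\<Union>x\<in>insert None (Some ` Z2). B x)"
      and close: "\<And>a l. a < m \<Longrightarrow> cmod (coeff (v1 a + Polynomial.smult t (w a)) l - coeff (v1 a) l) < \<delta> / 2"
    using \<delta> by auto
  define v' where "v' a = v1 a + Polynomial.smult t (w a)" for a
  show ?thesis
  proof (rule that)
    fix a assume a: "a < m"
    show "grade_le k (v' a)" unfolding v'_def by (intro grade_le_add grade_le_smult v1 w a)
    fix l
    show "cmod (coeff (v' a) l - coeff (v a) l) < \<delta>"
      using norm_diff_triangle_less[OF close[OF a, of l] close0[OF a, of l, folded v1_def]]
      by (simp add: v'_def)
  next
    fix x
    have "t \<notin> B x"
    proof (cases "x \<in> insert None (Some ` Z2)")
      case True then show ?thesis using t by blast
    next
      case False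
      then obtain \<gamma> where "x = Some \<gamma>" "\<gamma> \<notin> Z2" by (cases x) auto
      then show ?thesis using Bempty by simp
    qed
    then show "\<not> ?span x (\<lambda>a. grade_eval k x (v' a))"
      by (simp add: B_def v'_def grade_eval_add grade_eval_smult)
  qed
qed

text \<open>Rows are corrected one at a time. The bound \<open>card I < m\<close> for the enlarged
  set leaves the two free dimensions that \<open>perturb_row\<close> asks for.\<close>

lemma perturb_rows:
  assumes "finite I" "I \<subseteq> {..<m}" "card I < m" "\<And>i. i \<in> I \<Longrightarrow> 0 \<le> n i"
    "\<And>i a. i \<in> I \<Longrightarrow> a < m \<Longrightarrow> grade_le (n i) (N i a)" "\<delta> > 0"
  shows "\<exists>N'. (\<forall>i\<in>I. \<forall>a<m. grade_le (n i) (N' i a) \<and> (\<forall>l. cmod (coeff (N' i a) l - coeff (N i a) l) < \<delta>)) \<and>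
     (\<forall>x. inj_cols {..<m} I (\<lambda>a i. grade_eval (n i) x (N' i a)))"
  using assms
proof (induction I rule: finite_induct)
  case empty
  then show ?case by (auto simp: inj_cols_def)
next
  case (insert p I)
  have "\<exists>N'. (\<forall>i\<in>I. \<forall>a<m. grade_le (n i) (N' i a) \<and> (\<forall>l. cmod (coeff (N' i a) l - coeff (N i a) l) < \<delta>)) \<and>
     (\<forall>x. inj_cols {..<m} I (\<lambda>a i. grade_eval (n i) x (N' i a)))"
    by (rule insert.IH) (use insert in auto)
  then obtain N' where N': "\<And>i a. i \<in> I \<Longrightarrow> a < m \<Longrightarrow> grade_le (n i) (N' i a) \<and> (\<forall>l. cmod (coeff (N' i a) l - coeff (N i a) l) < \<delta>)"
    and inj: "\<And>x. inj_cols {..<m} I (\<lambda>a i. grade_eval (n i) x (N' i a))"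
    by blast
  obtain v' where v': "\<And>a. a < m \<Longrightarrow> grade_le (n p) (v' a)"
    "\<And>a l. a < m \<Longrightarrow> cmod (coeff (v' a) l - coeff (N p a) l) < \<delta>"
    "\<And>x. \<not> in_col_span m I (\<lambda>a i. grade_eval (n i) x (N' i a)) (\<lambda>a. grade_eval (n p) x (v' a))"
    by (rule perturb_row[of I m p n N' "n p" "N p" \<delta>]) (use insert inj in auto)
  define N2 where "N2 = N'(p := v')"
  have N2: "N2 i = N' i" if "i \<in> I" for i using that insert.hyps by (auto simp: N2_def)
  have "inj_cols {..<m} (insert p I) (\<lambda>a i. grade_eval (n i) x (N2 i a))" for x
  proof (rule inj_cols_insertI)
    show "inj_cols {..<m} I (\<lambda>a i. grade_eval (n i) x (N2 i a))"
      using inj[of x] N2 inj_cols_cong[of "{..<m}" I "\<lambda>a i. grade_eval (n i) x (N2 i a)" "\<lambda>a i. grade_eval (n i) x (N' i a)"]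
      by simp
    show "\<not> in_col_span m I (\<lambda>a i. grade_eval (n i) x (N2 i a)) (\<lambda>a. grade_eval (n p) x (N2 p a))"
      using v'(3)[of x] N2 in_col_span_cong[of m I "\<lambda>a i. grade_eval (n i) x (N2 i a)" "\<lambda>a i. grade_eval (n i) x (N' i a)"
          "\<lambda>a. grade_eval (n p) x (N2 p a)" "\<lambda>a. grade_eval (n p) x (v' a)"]
      by (simp add: N2_def)
  qed (use insert.hyps in auto)
  moreover have "\<forall>i\<in>insert p I. \<forall>a<m. grade_le (n i) (N2 i a) \<and> (\<forall>l. cmod (coeff (N2 i a) l - coeff (N i a) l) < \<delta>)"
    using N' v' N2 by (simp add: N2_def)
  ultimately show ?case by blast
qed

section \<open>Normal rank and eigenvalues\<close>

lemma normal_rank_ge_minor: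
  assumes P: "P \<in> carrier_mat m m" and R: "R \<subseteq> {..<m}" and J: "J \<subseteq> {..<m}"
    and det: "det (submatrix P R J) \<noteq> 0"
  shows "card J \<le> normal_rank m P"
proof -
  interpret comm_ring_hom "to_fract :: complex poly \<Rightarrow> complex poly fract" by unfold_locales auto
  let ?P = "map_mat to_fract P"
  have "det (submatrix ?P R J) = to_fract (det (submatrix P R J))"
    by (simp add: map_mat_submatrix[OF P R J, symmetric])
  then have "det (submatrix ?P R J) \<noteq> 0" using det by simp
  moreover have "?P \<in> carrier_mat m m" using P by simp
  ultimately have "card {j. j < m \<and> j \<in> J} \<le> vec_space.rank m ?P" by (rule vec_space.rank_gt_minor[rotated])
  moreover have "{j. j < m \<and> j \<in> J} = J" using J by auto
  ultimately show ?thesis by (simp add: normal_rank_def)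
qed

text \<open>Independent columns and then suitable rows are selected over the fraction field;
  injectivity of \<open>to_fract\<close> brings the minor back to polynomials.\<close>

lemma normal_rank_minor:
  assumes P: "P \<in> carrier_mat m m"
  obtains R J where "R \<subseteq> {..<m}" "J \<subseteq> {..<m}" "card R = card J" "card J = normal_rank m P"
    "det (submatrix P R J) \<noteq> 0"
proof -
  interpret comm_ring_hom "to_fract :: complex poly \<Rightarrow> complex poly fract" by unfold_locales auto
  let ?P = "map_mat to_fract P"
  have P': "?P \<in> carrier_mat m m" using P by simp
  obtain J where J: "J \<subseteq> {..<m}" "card J = vec_space.rank m ?P" "inj_cols {..<m} J (\<lambda>i j. ?P $$ (i, j))"
    by (rule vec_space.rank_indep_cols[OF P'])
  have "finite J" by (rule finite_subset[OF J(1)]) simp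
  then obtain R where R: "R \<subseteq> {..<m}" "card R = card J" "inj_cols R J (\<lambda>i j. ?P $$ (i, j))"
    by (rule inj_cols_select_rows[OF finite_lessThan _ J(3)])
  have "det (submatrix ?P R J) \<noteq> 0" using det_submatrix_neq_0_iff[OF P' R(1) J(1) R(2)] R(3) by blast
  moreover have "det (submatrix ?P R J) = to_fract (det (submatrix P R J))"
    by (simp add: map_mat_submatrix[OF P R(1) J(1), symmetric])
  ultimately have "det (submatrix P R J) \<noteq> 0" by auto
  then show ?thesis using that R J by (simp add: normal_rank_def)
qed

text \<open>A minor that is nonzero at one point is a nonzero polynomial, so specialisation cannot
  raise the rank.\<close>

lemma normal_rank_ge_at_point:
  assumes P: "P \<in> carrier_mat m m" and J: "J \<subseteq> {..<m}"
    and inj: "inj_cols {..<m} J (\<lambda>a b. poly (P $$ (a, b)) \<alpha>)"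
  shows "card J \<le> normal_rank m P"
proof -
  have "finite J" by (rule finite_subset[OF J]) simp
  then obtain R where R: "R \<subseteq> {..<m}" "card R = card J" "inj_cols R J (\<lambda>a b. poly (P $$ (a, b)) \<alpha>)"
    by (rule inj_cols_select_rows[OF finite_lessThan _ inj])
  have "inj_cols R J (\<lambda>i j. map_mat (\<lambda>p. poly p \<alpha>) P $$ (i, j))
      \<longleftrightarrow> inj_cols R J (\<lambda>a b. poly (P $$ (a, b)) \<alpha>)"
    using R(1) J P by (intro inj_cols_cong) (auto simp: subset_iff)
  moreover have "map_mat (\<lambda>p. poly p \<alpha>) P \<in> carrier_mat m m" using P by simp
  ultimately have "det (submatrix (map_mat (\<lambda>p. poly p \<alpha>) P) R J) \<noteq> 0"
    using det_submatrix_neq_0_iff R J by blast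
  then have "poly (det (submatrix P R J)) \<alpha> \<noteq> 0"
    unfolding poly_det map_mat_submatrix[OF P R(1) J] .
  then have "det (submatrix P R J) \<noteq> 0" by auto
  then show ?thesis by (rule normal_rank_ge_minor[OF P R(1) J])
qed

text \<open>More than \<open>card I\<close> columns of \<open>G\<close> satisfy a relation over the
  fraction field, and the product inherits it.\<close>

lemma normal_rank_le_factor:
  assumes P: "P \<in> carrier_mat m m" and fin: "finite I"
    and fac: "\<And>a b. a < m \<Longrightarrow> b < m \<Longrightarrow> P $$ (a, b) = (\<Sum>i\<in>I. F a i * G i b)"
  shows "normal_rank m P \<le> card I"
proof (rule ccontr)
  interpret comm_ring_hom "to_fract :: complex poly \<Rightarrow> complex poly fract" by unfold_locales auto
  let ?P = "map_mat to_fract P"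
  have P': "?P \<in> carrier_mat m m" using P by simp
  assume "\<not> ?thesis"
  moreover obtain J where J: "J \<subseteq> {..<m}" "card J = vec_space.rank m ?P" "inj_cols {..<m} J (\<lambda>i j. ?P $$ (i, j))"
    by (rule vec_space.rank_indep_cols[OF P'])
  moreover have finJ: "finite J" by (rule finite_subset[OF J(1)]) simp
  ultimately have "\<not> inj_cols I J (\<lambda>i b. to_fract (G i b))"
    using fin by (intro not_inj_cols_if_card_less) (auto simp: normal_rank_def)
  then obtain c b where c: "\<And>i. i \<in> I \<Longrightarrow> (\<Sum>b\<in>J. to_fract (G i b) * c b) = 0" and b: "b \<in> J" "c b \<noteq> 0"
    unfolding inj_cols_def by blast
  have "(\<Sum>b\<in>J. ?P $$ (a, b) * c b) = 0" if a: "a \<in> {..<m}" for a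
  proof -
    have "(\<Sum>b\<in>J. ?P $$ (a, b) * c b) = (\<Sum>b\<in>J. \<Sum>i\<in>I. to_fract (F a i) * (to_fract (G i b) * c b))"
      using a J(1) P by (intro sum.cong) (auto simp: fac hom_sum hom_mult sum_distrib_left mult_ac subset_iff)
    also have "\<dots> = (\<Sum>i\<in>I. to_fract (F a i) * (\<Sum>b\<in>J. to_fract (G i b) * c b))"
      by (subst sum.swap) (simp add: sum_distrib_left)
    also have "\<dots> = 0" using c by simp
    finally show ?thesis .
  qed
  from inj_colsD[OF J(3) this b(1)] b(2) show False by blast
qed

section \<open>Smith form and absence of eigenvalues\<close>

lemma mult_mat_index3:
  assumes "A \<in> carrier_mat m m" "B \<in> carrier_mat m m" "C \<in> carrier_mat m m" "a < m" "b < m"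
  shows "(A * B * C) $$ (a, b) = (\<Sum>e<m. \<Sum>f<m. A $$ (a, e) * B $$ (e, f) * C $$ (f, b))"
  using assms by (simp add: scalar_prod_def lessThan_atLeast0 sum_distrib_left mult.assoc)

lemma invertible_mat_inverse:
  assumes "U \<in> carrier_mat m m" "invertible_mat U"
  obtains U' where "U' \<in> carrier_mat m m" "U * U' = 1\<^sub>m m" "U' * U = 1\<^sub>m m"
proof -
  obtain U' where U': "U * U' = 1\<^sub>m m" "U' * U = 1\<^sub>m (dim_row U')"
    using assms unfolding invertible_mat_def inverts_mat_def by auto
  have "dim_col U' = m" using arg_cong[OF U'(1), of dim_col] by simp
  moreover have "dim_row U' = m" using arg_cong[OF U'(2), of dim_col] assms(1) by simp
  ultimately show ?thesis using that[of U'] U' by auto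
qed

text \<open>The number of nonzero entries of the Smith form is at most \<open>card I\<close> by the factorisation at a
  generic point; a root of one of them at \<open>\<alpha>\<close> would make the rank at \<open>\<alpha>\<close> smaller than \<open>card I\<close>.\<close>

lemma not_finite_eigenvalue:
  assumes Q: "Q \<in> carrier_mat m m" and fin: "finite I" and J: "J \<subseteq> {..<m}" "card J = card I"
    and fac: "\<And>\<beta>. \<beta> \<noteq> 0 \<Longrightarrow> \<exists>F G. \<forall>a<m. \<forall>b<m. poly (Q $$ (a, b)) \<beta> = (\<Sum>i\<in>I. F a i * G i b)"
    and inj: "inj_cols {..<m} J (\<lambda>a b. poly (Q $$ (a, b)) \<alpha>)"
  shows "\<not> finite_eigenvalue Q \<alpha>"
proof
  assume "finite_eigenvalue Q \<alpha>"
  then obtain S p where smith: "smith_form_of Q S" and p: "p < min (dim_row S) (dim_col S)"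
    "S $$ (p, p) \<noteq> 0" "poly (S $$ (p, p)) \<alpha> = 0"
    unfolding finite_eigenvalue_def invariant_polys_def by blast
  obtain U V where U: "U \<in> carrier_mat m m" "invertible_mat U" and V: "V \<in> carrier_mat m m" "invertible_mat V"
    and S: "S = U * Q * V" and diag: "diagonal_mat S"
    using smith Q unfolding smith_form_of_def by auto
  have Sc: "S \<in> carrier_mat m m" using S U V Q by auto
  have pm: "p < m" using p Sc by simp
  have Sdiag: "S $$ (a, b) = 0" if "a < m" "b < m" "a \<noteq> b" for a b
    using diag that Sc by (simp add: diagonal_mat_def)
  obtain U' where U': "U' \<in> carrier_mat m m" "U * U' = 1\<^sub>m m" "U' * U = 1\<^sub>m m"
    by (rule invertible_mat_inverse[OF U])
  obtain V' where V': "V' \<in> carrier_mat m m" "V * V' = 1\<^sub>m m" "V' * V = 1\<^sub>m m"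
    by (rule invertible_mat_inverse[OF V])
  have "U' * S * V' = (U' * U) * Q * (V * V')"
    using U(1) V(1) U'(1) V'(1) Q unfolding S
    by (simp add: assoc_mult_mat[of _ m m _ m _ m] mult_carrier_mat[of _ m m _ m])
  then have Q': "Q = U' * S * V'" using U' V' Q by simp
  define D where "D = {i. i < m \<and> S $$ (i, i) \<noteq> 0}"
  have finD: "finite D" by (simp add: D_def)
  have pD: "p \<in> D" using pm p(2) by (simp add: D_def)
  have "card D \<le> card I"
  proof (rule ccontr)
    assume "\<not> card D \<le> card I"
    \<comment> \<open>A generic \<beta>: different from 0, where no factorisation is assumed, and
      not a root of any nonzero diagonal entry of \<open>S\<close>.\<close>
    have "finite (insert 0 (\<Union>i\<in>D. {s. poly (S $$ (i, i)) s = 0}))"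
      using finD by (auto simp: D_def intro!: poly_roots_finite)
    then obtain \<beta> where \<beta>: "\<beta> \<notin> insert 0 (\<Union>i\<in>D. {s. poly (S $$ (i, i)) s = 0})"
      using ex_new_if_finite infinite_UNIV_char_0 by blast
    then obtain F G where FG: "\<forall>a<m. \<forall>b<m. poly (Q $$ (a, b)) \<beta> = (\<Sum>i\<in>I. F a i * G i b)"
      using fac[of \<beta>] by blast
    \<comment> \<open>With \<open>S = U F G V\<close> at \<beta>, the vector \<open>c\<close> kills
      \<open>G V\<close> on the columns \<open>D\<close>, hence \<open>S\<close> as well; row
      \<open>q\<close> of the diagonal matrix \<open>S\<close> then yields the
      contradiction.\<close>
    have "\<not> inj_cols I D (\<lambda>i b. \<Sum>f<m. G i f * poly (V $$ (f, b)) \<beta>)"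
      using \<open>\<not> card D \<le> card I\<close> fin finD by (intro not_inj_cols_if_card_less) auto
    then obtain c q where c: "\<And>i. i \<in> I \<Longrightarrow> (\<Sum>b\<in>D. (\<Sum>f<m. G i f * poly (V $$ (f, b)) \<beta>) * c b) = 0"
      and q: "q \<in> D" "c q \<noteq> 0" unfolding inj_cols_def by blast
    have qm: "q < m" using q by (simp add: D_def)
    define H where "H i = (\<Sum>e<m. poly (U $$ (q, e)) \<beta> * F e i)" for i
    have Sb: "poly (S $$ (q, b)) \<beta> = (\<Sum>i\<in>I. H i * (\<Sum>f<m. G i f * poly (V $$ (f, b)) \<beta>))" if b: "b < m" for b
    proof -
      have "poly (S $$ (q, b)) \<beta> = (\<Sum>e<m. \<Sum>f<m. poly (U $$ (q, e)) \<beta> * (\<Sum>i\<in>I. F e i * G i f) * poly (V $$ (f, b)) \<beta>)"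
        unfolding S mult_mat_index3[OF U(1) Q V(1) qm b] using FG by (simp add: poly_sum)
      also have "\<dots> = (\<Sum>e<m. \<Sum>f<m. \<Sum>i\<in>I. poly (U $$ (q, e)) \<beta> * F e i * (G i f * poly (V $$ (f, b)) \<beta>))"
        by (simp add: sum_distrib_left sum_distrib_right mult_ac)
      also have "\<dots> = (\<Sum>e<m. \<Sum>i\<in>I. \<Sum>f<m. poly (U $$ (q, e)) \<beta> * F e i * (G i f * poly (V $$ (f, b)) \<beta>))"
        by (intro sum.cong refl sum.swap)
      also have "\<dots> = (\<Sum>i\<in>I. \<Sum>e<m. \<Sum>f<m. poly (U $$ (q, e)) \<beta> * F e i * (G i f * poly (V $$ (f, b)) \<beta>))"
        by (rule sum.swap)
      also have "\<dots> = (\<Sum>i\<in>I. H i * (\<Sum>f<m. G i f * poly (V $$ (f, b)) \<beta>))"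
        unfolding H_def sum_product ..
      finally show ?thesis .
    qed
    have "poly (S $$ (q, q)) \<beta> * c q = (\<Sum>b\<in>D. poly (S $$ (q, b)) \<beta> * c b)"
    proof -
      have "(\<Sum>b\<in>D. poly (S $$ (q, b)) \<beta> * c b) = (\<Sum>b\<in>{q}. poly (S $$ (q, b)) \<beta> * c b)"
        using finD q(1) qm Sdiag by (intro sum.mono_neutral_right) (auto simp: D_def)
      then show ?thesis by simp
    qed
    also have "\<dots> = (\<Sum>b\<in>D. \<Sum>i\<in>I. H i * ((\<Sum>f<m. G i f * poly (V $$ (f, b)) \<beta>) * c b))"
      by (intro sum.cong refl) (simp add: D_def Sb sum_distrib_right mult.assoc)
    also have "\<dots> = (\<Sum>i\<in>I. H i * (\<Sum>b\<in>D. (\<Sum>f<m. G i f * poly (V $$ (f, b)) \<beta>) * c b))"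
      by (subst sum.swap) (simp add: sum_distrib_left)
    also have "\<dots> = 0" using c by simp
    finally show False using q \<beta> by auto
  qed
  \<comment> \<open>At \<alpha> the entry \<open>p\<close> vanishes too, so only the rows
    \<open>D - {p}\<close> of \<open>V'\<close> matter. They are fewer than the columns
    \<open>J\<close>, so some nonzero vector on \<open>J\<close> is killed by them and therefore by
    the value of \<open>Q\<close>.\<close>
  then have "card (D - {p}) < card J" using pD finD J by (metis card_Diff1_less order_less_le_trans)
  moreover have finJ: "finite J" by (rule finite_subset[OF J(1)]) simp
  ultimately have "\<not> inj_cols (D - {p}) J (\<lambda>e b. poly (V' $$ (e, b)) \<alpha>)"
    using finD by (intro not_inj_cols_if_card_less) auto
  then obtain c q where c: "\<And>e. e \<in> D - {p} \<Longrightarrow> (\<Sum>b\<in>J. poly (V' $$ (e, b)) \<alpha> * c b) = 0"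
    and q: "q \<in> J" "c q \<noteq> 0" unfolding inj_cols_def by blast
  have "(\<Sum>b\<in>J. poly (Q $$ (a, b)) \<alpha> * c b) = 0" if "a \<in> {..<m}" for a
  proof -
    have a: "a < m" using that by simp
    have Qe: "poly (Q $$ (a, b)) \<alpha> = (\<Sum>e<m. poly (U' $$ (a, e)) \<alpha> * poly (S $$ (e, e)) \<alpha> * poly (V' $$ (e, b)) \<alpha>)"
      if b: "b < m" for b
    proof -
      have "Q $$ (a, b) = (\<Sum>e<m. \<Sum>f<m. U' $$ (a, e) * S $$ (e, f) * V' $$ (f, b))"
        by (subst Q') (rule mult_mat_index3[OF U'(1) Sc V'(1) a b])
      also have "\<dots> = (\<Sum>e<m. U' $$ (a, e) * S $$ (e, e) * V' $$ (e, b))"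
      proof (intro sum.cong refl)
        fix e assume e: "e \<in> {..<m}"
        have "(\<Sum>f<m. U' $$ (a, e) * S $$ (e, f) * V' $$ (f, b)) = (\<Sum>f\<in>{e}. U' $$ (a, e) * S $$ (e, f) * V' $$ (f, b))"
          using e Sdiag by (intro sum.mono_neutral_right) auto
        then show "(\<Sum>f<m. U' $$ (a, e) * S $$ (e, f) * V' $$ (f, b)) = U' $$ (a, e) * S $$ (e, e) * V' $$ (e, b)" by simp
      qed
      finally show ?thesis by (simp add: poly_sum)
    qed
    have "(\<Sum>b\<in>J. poly (Q $$ (a, b)) \<alpha> * c b) =
        (\<Sum>b\<in>J. \<Sum>e<m. poly (U' $$ (a, e)) \<alpha> * poly (S $$ (e, e)) \<alpha> * (poly (V' $$ (e, b)) \<alpha> * c b))"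
      using J(1) by (intro sum.cong refl) (auto simp: Qe sum_distrib_right mult.assoc subset_iff)
    also have "\<dots> = (\<Sum>e<m. poly (U' $$ (a, e)) \<alpha> * poly (S $$ (e, e)) \<alpha> * (\<Sum>b\<in>J. poly (V' $$ (e, b)) \<alpha> * c b))"
      by (subst sum.swap) (simp add: sum_distrib_left)
    also have "\<dots> = 0"
    proof (intro sum.neutral ballI)
      fix e assume "e \<in> {..<m}"
      then consider "e \<in> D - {p}" | "e = p" | "S $$ (e, e) = 0" by (auto simp: D_def)
      then show "poly (U' $$ (a, e)) \<alpha> * poly (S $$ (e, e)) \<alpha> * (\<Sum>b\<in>J. poly (V' $$ (e, b)) \<alpha> * c b) = 0"
        using c p(3) by cases auto
    qed
    finally show ?thesis .
  qed
  from inj_colsD[OF inj this q(1)] q(2) show False by blast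
qed

section \<open>Closure\<close>

lemma POL_ss_iff:
  "P \<in> POL_ss d m \<longleftrightarrow> P \<in> carrier_mat m m \<and>
     (\<forall>a<m. \<forall>b<m. grade_le (int d) (P $$ (a, b)) \<and> P $$ (b, a) = - P $$ (a, b))"
proof
  assume P: "P \<in> POL_ss d m"
  have hi: "coeff (P $$ (a, b)) i = 0" if "i > d" "a < m" "b < m" for i a b
  proof -
    have "coeff_mat m i P $$ (a, b) = 0" using P that by (simp add: POL_ss_def)
    then show ?thesis using that by (simp add: coeff_mat_def)
  qed
  have lo: "coeff (P $$ (b, a)) i = - coeff (P $$ (a, b)) i" if "i \<le> d" "a < m" "b < m" for i a b
  proof -
    have "transpose_mat (coeff_mat m i P) $$ (a, b) = (- coeff_mat m i P) $$ (a, b)"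
      using P that by (simp add: POL_ss_def)
    then show ?thesis using that by (simp add: coeff_mat_def)
  qed
  have "P $$ (b, a) = - P $$ (a, b)" if "a < m" "b < m" for a b
  proof (rule poly_eqI)
    fix i
    show "coeff (P $$ (b, a)) i = coeff (- P $$ (a, b)) i"
      using hi[of i a b] hi[of i b a] lo[of i a b] that by (cases "i \<le> d") auto
  qed
  moreover have "grade_le (int d) (P $$ (a, b))" if "a < m" "b < m" for a b
    using hi that by (auto simp: grade_le_def)
  moreover have "P \<in> carrier_mat m m" using P by (simp add: POL_ss_def)
  ultimately show "P \<in> carrier_mat m m \<and>
     (\<forall>a<m. \<forall>b<m. grade_le (int d) (P $$ (a, b)) \<and> P $$ (b, a) = - P $$ (a, b))"
    by blast
next
  assume *: "P \<in> carrier_mat m m \<and>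
     (\<forall>a<m. \<forall>b<m. grade_le (int d) (P $$ (a, b)) \<and> P $$ (b, a) = - P $$ (a, b))"
  then have P: "P \<in> carrier_mat m m" and grade: "\<And>a b. a < m \<Longrightarrow> b < m \<Longrightarrow> grade_le (int d) (P $$ (a, b))"
    by blast+
  have "transpose_mat (coeff_mat m i P) = - coeff_mat m i P" for i
  proof (rule eq_matI)
    fix a b assume "a < dim_row (- coeff_mat m i P)" "b < dim_col (- coeff_mat m i P)"
    then have ab: "a < m" "b < m" by (auto simp: coeff_mat_def)
    then have "P $$ (b, a) = - P $$ (a, b)" using * by blast
    then show "transpose_mat (coeff_mat m i P) $$ (a, b) = (- coeff_mat m i P) $$ (a, b)"
      using ab by (simp add: coeff_mat_def)
  qed (auto simp: coeff_mat_def)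
  moreover have "coeff_mat m i P = 0\<^sub>m m m" if "i > d" for i
    using grade that by (intro eq_matI) (auto simp: coeff_mat_def grade_le_def)
  ultimately show "P \<in> POL_ss d m" using P by (simp add: POL_ss_def)
qed

section \<open>From representations to polynomials without eigenvalues\<close>

lemma skew_rep_grade_eval:
  assumes rep: "skew_rep d m P I n N X" and "a < m" "b < m"
  shows "grade_eval (int d) x (P a b) = (\<Sum>i\<in>I. grade_eval (n i) x (N i a) *
    (\<Sum>j\<in>I. grade_eval (int d - n i - n j) x (X i j) * grade_eval (n j) x (N j b)))"
proof -
  have Ng: "\<And>i a. i \<in> I \<Longrightarrow> a < m \<Longrightarrow> grade_le (n i) (N i a)"
    and Xg: "\<And>i j. i \<in> I \<Longrightarrow> j \<in> I \<Longrightarrow> grade_le (int d - n i - n j) (X i j)"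
    and "P a b = (\<Sum>i\<in>I. \<Sum>j\<in>I. N i a * X i j * N j b)"
    using rep assms(2,3) unfolding skew_rep_def by blast+
  then have "grade_eval (int d) x (P a b) = (\<Sum>i\<in>I. \<Sum>j\<in>I. grade_eval (int d) x (N i a * X i j * N j b))"
    by (simp add: grade_eval_sum)
  also have "\<dots> = (\<Sum>i\<in>I. \<Sum>j\<in>I. grade_eval (n i) x (N i a) *
      grade_eval (int d - n i - n j) x (X i j) * grade_eval (n j) x (N j b))"
    by (intro sum.cong refl grade_eval_mult3) (simp_all add: Ng Xg assms)
  finally show ?thesis by (simp add: sum_distrib_left mult.assoc)
qed

text \<open>The value at \<open>x\<close> is a product \<open>N\<^sup>T X N\<close>. Choosing
  \<open>J\<close> so that the square block of \<open>N\<close> on \<open>J\<close> is invertible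
  makes all three factors injective in turn.\<close>

lemma skew_rep_inj_cols:
  assumes rep: "skew_rep d m P I n N X" and X: "nonsingular_at d I n X x"
    and N: "inj_cols {..<m} I (\<lambda>a i. grade_eval (n i) x (N i a))"
  obtains J where "J \<subseteq> {..<m}" "card J = card I" "inj_cols {..<m} J (\<lambda>a b. grade_eval (int d) x (P a b))"
proof -
  have I: "I \<subseteq> {..<m}" using rep unfolding skew_rep_def by blast
  have fin: "finite I" by (rule finite_subset[OF I]) simp
  obtain J where J: "J \<subseteq> {..<m}" "card J = card I" "inj_cols J I (\<lambda>a i. grade_eval (n i) x (N i a))"
    by (rule inj_cols_select_rows[OF finite_lessThan fin N])
  have finJ: "finite J" by (rule finite_subset[OF J(1)]) simp
  have NJ: "inj_cols I J (\<lambda>i a. grade_eval (n i) x (N i a))"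
    by (rule inj_cols_transpose[OF finJ fin J(2,3)])
  have "inj_cols {..<m} J (\<lambda>a b. grade_eval (int d) x (P a b))"
    unfolding inj_cols_def
  proof (intro allI impI ballI)
    fix c b assume c: "\<forall>a\<in>{..<m}. (\<Sum>b\<in>J. grade_eval (int d) x (P a b) * c b) = 0" and b: "b \<in> J"
    define z where "z j = (\<Sum>b\<in>J. grade_eval (n j) x (N j b) * c b)" for j
    define y where "y i = (\<Sum>j\<in>I. grade_eval (int d - n i - n j) x (X i j) * z j)" for i
    have "(\<Sum>i\<in>I. grade_eval (n i) x (N i a) * y i) = 0" if a: "a \<in> {..<m}" for a
    proof -
      have "(\<Sum>b\<in>J. grade_eval (int d) x (P a b) * c b) = (\<Sum>b\<in>J. \<Sum>i\<in>I. \<Sum>j\<in>I. grade_eval (n i) x (N i a) *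
          (grade_eval (int d - n i - n j) x (X i j) * (grade_eval (n j) x (N j b) * c b)))"
        using a J(1) by (intro sum.cong refl)
          (auto simp: skew_rep_grade_eval[OF rep] sum_distrib_left sum_distrib_right mult.assoc subset_iff)
      also have "\<dots> = (\<Sum>i\<in>I. \<Sum>b\<in>J. \<Sum>j\<in>I. grade_eval (n i) x (N i a) *
          (grade_eval (int d - n i - n j) x (X i j) * (grade_eval (n j) x (N j b) * c b)))"
        by (rule sum.swap)
      also have "\<dots> = (\<Sum>i\<in>I. \<Sum>j\<in>I. \<Sum>b\<in>J. grade_eval (n i) x (N i a) *
          (grade_eval (int d - n i - n j) x (X i j) * (grade_eval (n j) x (N j b) * c b)))"
        by (intro sum.cong refl sum.swap)
      also have "\<dots> = (\<Sum>i\<in>I. grade_eval (n i) x (N i a) * y i)"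
        by (simp add: y_def z_def sum_distrib_left)
      finally show ?thesis using c a by simp
    qed
    then have y0: "y i = 0" if "i \<in> I" for i using inj_colsD[OF N] that by blast
    have z0: "z j = 0" if "j \<in> I" for j
      by (rule inj_colsD[OF X[unfolded nonsingular_at_def] _ that]) (use y0 in \<open>simp add: y_def\<close>)
    show "c b = 0" by (rule inj_colsD[OF NJ _ b]) (use z0 in \<open>simp add: z_def\<close>)
  qed
  then show ?thesis using that J by blast
qed

lemma poly_eq_sum_grade:
  assumes "grade_le (int d) p"
  shows "poly p x = (\<Sum>i\<le>d. coeff p i * x ^ i)"
proof -
  have "poly p x = (\<Sum>i\<le>degree p. coeff p i * x ^ i)" by (rule poly_altdef)
  also have "\<dots> = (\<Sum>i\<le>d. coeff p i * x ^ i)"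
    using assms by (intro sum.mono_neutral_left) (auto simp: grade_le_iff_degree coeff_eq_0)
  finally show ?thesis .
qed

lemma poly_rev:
  assumes "grade_le (int d) p"
  shows "poly (\<Sum>i\<le>d. monom (coeff p i) (d - i)) \<beta> = (if \<beta> = 0 then coeff p d else \<beta> ^ d * poly p (1 / \<beta>))"
proof (cases "\<beta> = 0")
  case True
  have "(\<Sum>i\<le>d. coeff p i * 0 ^ (d - i)) = (\<Sum>i\<in>{d}. coeff p i * 0 ^ (d - i))"
    by (intro sum.mono_neutral_right) auto
  then show ?thesis using True by (simp add: poly_sum poly_monom)
next
  case False
  have "\<beta> ^ d * poly p (1 / \<beta>) = (\<Sum>i\<le>d. coeff p i * \<beta> ^ (d - i))"
    unfolding poly_eq_sum_grade[OF assms] sum_distrib_left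
    using False by (intro sum.cong refl) (simp add: power_diff power_one_over field_simps)
  then show ?thesis using False by (simp add: poly_sum poly_monom)
qed

text \<open>The factorisation bounds the normal rank by \<open>card I\<close>, while at every point
  of the projective line the value has \<open>card I\<close> independent columns. So the rank never
  drops.\<close>

lemma skew_rep_POL_ss_neig:
  assumes P: "P \<in> carrier_mat m m" and rep: "skew_rep d m (\<lambda>a b. P $$ (a, b)) I n N X"
    and X: "\<And>x. nonsingular_at d I n X x"
    and N: "\<And>x. inj_cols {..<m} I (\<lambda>a i. grade_eval (n i) x (N i a))"
    and I0: "card I > 0"
  shows "P \<in> POL_ss_neig d (card I) m"
proof -
  have I: "I \<subseteq> {..<m}"
    and Ng: "\<And>i a. i \<in> I \<Longrightarrow> a < m \<Longrightarrow> grade_le (n i) (N i a)"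
    and Xg: "\<And>i j. i \<in> I \<Longrightarrow> j \<in> I \<Longrightarrow> grade_le (int d - n i - n j) (X i j)"
    and skew: "\<And>i j. i \<in> I \<Longrightarrow> j \<in> I \<Longrightarrow> X j i = - X i j"
    and Pe: "\<And>a b. a < m \<Longrightarrow> b < m \<Longrightarrow> P $$ (a, b) = (\<Sum>i\<in>I. \<Sum>j\<in>I. N i a * X i j * N j b)"
    using rep unfolding skew_rep_def by blast+
  have fin: "finite I" by (rule finite_subset[OF I]) simp
  have Pg: "grade_le (int d) (P $$ (a, b))" if "a < m" "b < m" for a b
    unfolding Pe[OF that]
  proof (intro grade_le_sum)
    fix i j assume ij: "i \<in> I" "j \<in> I"
    have "grade_le (n i + (int d - n i - n j) + n j) (N i a * X i j * N j b)"
      by (intro grade_le_mult Ng Xg ij that)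
    then show "grade_le (int d) (N i a * X i j * N j b)" by simp
  qed
  have ss: "P \<in> POL_ss d m"
    unfolding POL_ss_iff
  proof (intro conjI allI impI)
    fix a b assume "a < m" "b < m"
    then show "P $$ (b, a) = - P $$ (a, b)"
      unfolding Pe[OF \<open>b < m\<close> \<open>a < m\<close>] Pe[OF \<open>a < m\<close> \<open>b < m\<close>] by (intro skew_form_swap skew)
  qed (use P Pg in auto)
  have fac: "P $$ (a, b) = (\<Sum>i\<in>I. N i a * (\<Sum>j\<in>I. X i j * N j b))" if "a < m" "b < m" for a b
    using Pe[OF that] by (simp add: sum_distrib_left mult.assoc)
  have le: "normal_rank m P \<le> card I" by (rule normal_rank_le_factor[OF P fin fac])
  have ex: "\<exists>J\<subseteq>{..<m}. card J = card I \<and> inj_cols {..<m} J (\<lambda>a b. grade_eval (int d) x (P $$ (a, b)))" for x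
    by (rule skew_rep_inj_cols[OF rep X N, of x]) blast
  have rank: "normal_rank m P = card I"
  proof -
    obtain J where "J \<subseteq> {..<m}" "card J = card I" "inj_cols {..<m} J (\<lambda>a b. poly (P $$ (a, b)) 0)"
      using ex[of "Some 0"] by auto
    then have "card I \<le> normal_rank m P" using normal_rank_ge_at_point[OF P, of J 0] by simp
    then show ?thesis using le by simp
  qed
  obtain Ji where Ji: "Ji \<subseteq> {..<m}" "card Ji = card I"
    and "inj_cols {..<m} Ji (\<lambda>a b. grade_eval (int d) None (P $$ (a, b)))"
    using ex[of None] by blast
  \<comment> \<open>The value at infinity is the coefficient of degree \<open>d\<close>. It also
    settles the exact degree, and it is the value at 0 of the reversal.\<close>
  then have inf: "inj_cols {..<m} Ji (\<lambda>a b. coeff (P $$ (a, b)) d)" by (simp add: grade_eval_def)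
  have deg: "mat_poly_degree m P = d"
    unfolding mat_poly_degree_def
  proof (rule Greatest_equality)
    show "coeff_mat m d P \<noteq> 0\<^sub>m m m"
    proof
      assume z: "coeff_mat m d P = 0\<^sub>m m m"
      have z': "coeff (P $$ (a, b)) d = 0" if "a < m" "b < m" for a b
        using arg_cong[OF z, of "\<lambda>A. A $$ (a, b)"] that by (simp add: coeff_mat_def)
      \<comment> \<open>Positivity of \<open>card I\<close> supplies a column. If the coefficient
        matrix were zero, the all-ones vector would contradict independence.\<close>
      obtain j where j: "j \<in> Ji" using Ji(2) I0 by fastforce
      have "(\<Sum>b\<in>Ji. coeff (P $$ (a, b)) d * 1) = 0" if "a \<in> {..<m}" for a
        using that Ji(1) z' by (intro sum.neutral) auto
      from inj_colsD[OF inf this j] show False by simp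
    qed
    fix i assume nz: "coeff_mat m i P \<noteq> 0\<^sub>m m m"
    show "i \<le> d"
    proof (rule ccontr)
      assume "\<not> i \<le> d"
      then have "coeff_mat m i P = 0\<^sub>m m m" using ss by (simp add: POL_ss_def)
      then show False using nz by contradiction
    qed
  qed
  have fin_eig: "\<not> finite_eigenvalue P \<alpha>" for \<alpha>
  proof -
    obtain J where J: "J \<subseteq> {..<m}" "card J = card I" "inj_cols {..<m} J (\<lambda>a b. poly (P $$ (a, b)) \<alpha>)"
      using ex[of "Some \<alpha>"] by auto
    show ?thesis
    proof (rule not_finite_eigenvalue[OF P fin J(1,2) _ J(3)])
      fix \<beta> :: complex
      show "\<exists>F G. \<forall>a<m. \<forall>b<m. poly (P $$ (a, b)) \<beta> = (\<Sum>i\<in>I. F a i * G i b)"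
        by (rule exI[of _ "\<lambda>a i. poly (N i a) \<beta>"], rule exI[of _ "\<lambda>i b. poly (\<Sum>j\<in>I. X i j * N j b) \<beta>"])
          (simp add: fac poly_sum)
    qed
  qed
  have inf_eig: "\<not> infinite_eigenvalue d P"
    unfolding infinite_eigenvalue_def
  proof (rule not_finite_eigenvalue[OF _ fin Ji])
    let ?Q = "rev_mat_poly d P"
    show "?Q \<in> carrier_mat m m" using P by (simp add: rev_mat_poly_def)
    have Qe: "poly (?Q $$ (a, b)) \<beta> = (if \<beta> = 0 then coeff (P $$ (a, b)) d else \<beta> ^ d * poly (P $$ (a, b)) (1 / \<beta>))"
      if "a < m" "b < m" for a b \<beta>
      using that P poly_rev[OF Pg[OF that]] by (simp add: rev_mat_poly_def)
    show "inj_cols {..<m} Ji (\<lambda>a b. poly (?Q $$ (a, b)) 0)"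
      using inf inj_cols_cong[of "{..<m}" Ji "\<lambda>a b. poly (?Q $$ (a, b)) 0" "\<lambda>a b. coeff (P $$ (a, b)) d"] Qe Ji(1)
      by (auto simp: subset_iff)
    fix \<beta> :: complex assume \<beta>: "\<beta> \<noteq> 0"
    \<comment> \<open>For nonzero \<beta> the reversal is \<open>\<beta> ^ d\<close> times the value
      of \<open>P\<close> at \<open>1 / \<beta>\<close>; the scalar is absorbed into the left
      factor.\<close>
    show "\<exists>F G. \<forall>a<m. \<forall>b<m. poly (?Q $$ (a, b)) \<beta> = (\<Sum>i\<in>I. F a i * G i b)"
      by (rule exI[of _ "\<lambda>a i. \<beta> ^ d * poly (N i a) (1 / \<beta>)"],
          rule exI[of _ "\<lambda>i b. poly (\<Sum>j\<in>I. X i j * N j b) (1 / \<beta>)"])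
        (use \<beta> in \<open>simp add: Qe fac poly_sum sum_distrib_left mult.assoc\<close>)
  qed
  show ?thesis
    using ss rank deg fin_eig inf_eig by (simp add: POL_ss_neig_def POL_ss_rank_def)
qed

text \<open>The reduction starts from the trivial representation. The size of its result is at most
  the normal rank and is even, so hyperbolic pairs can fill it up to exactly
  \<open>2 * r\<close>.\<close>

lemma skew_rep_exists:
  assumes P: "P \<in> POL_ss d m" and rank: "normal_rank m P \<le> 2 * r" and r: "2 * r \<le> m"
  obtains I n N X where "skew_rep d m (\<lambda>a b. P $$ (a, b)) I n N X"
    "\<forall>x. nonsingular_at d I n X x" "card I = 2 * r"
proof -
  let ?P = "\<lambda>a b. P $$ (a, b)"
  have Pc: "P \<in> carrier_mat m m" using P unfolding POL_ss_iff by blast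
  have Psum: "(\<Sum>i<m. \<Sum>j<m. (if i = a then 1 else 0) * P $$ (i, j) * (if j = b then 1 else 0)) = P $$ (a, b)"
    if "a < m" "b < m" for a b
  proof -
    have "(\<Sum>j<m. (if i = a then 1 else 0) * P $$ (i, j) * (if j = b then 1 else 0))
        = (if i = a then P $$ (i, b) else 0)" for i
      using that by (cases "i = a") (simp_all add: if_distrib cong: if_cong)
    then show ?thesis using that by simp
  qed
  have "skew_rep d m ?P {..<m} (\<lambda>_. 0) (\<lambda>i a. if i = a then 1 else 0) ?P"
    unfolding skew_rep_def
  proof (intro conjI ballI allI impI)
    fix i j assume "i \<in> {..<m}" "j \<in> {..<m}"
    then have "i < m" "j < m" by simp_all
    then show "grade_le (int d - 0 - 0) (P $$ (i, j))" "P $$ (j, i) = - P $$ (i, j)"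
      using P unfolding POL_ss_iff diff_0_right by blast+
  qed (use Psum in \<open>auto simp: grade_le_iff_degree\<close>)
  moreover have "generically_indep m {..<m} (\<lambda>i a. if i = a then 1 else 0)"
  proof -
    have "inj_cols {..<m} {..<m} (\<lambda>a i. poly (if i = a then 1 else 0) \<alpha>)" for \<alpha> :: complex
      unfolding inj_cols_def
    proof (intro allI impI ballI)
      fix c :: "nat \<Rightarrow> complex" and j
      assume c: "\<forall>a\<in>{..<m}. (\<Sum>i<m. poly (if i = a then 1 else 0) \<alpha> * c i) = 0" and j: "j \<in> {..<m}"
      have "(\<Sum>i<m. poly (if i = j then 1 else 0) \<alpha> * c i) = (\<Sum>i<m. if i = j then c i else 0)"
        by (intro sum.cong) auto
      then show "c j = 0" using c j by simp
    qed
    then show ?thesis unfolding generically_indep_def by (metis finite.emptyI)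
  qed
  ultimately obtain I n N X where rep: "skew_rep d m ?P I n N X" and gen: "generically_indep m I N"
    and X: "\<forall>x. nonsingular_at d I n X x"
    using skew_rep_nonsingular_exists by blast
  have I: "I \<subseteq> {..<m}" and skew: "\<And>i j. i \<in> I \<Longrightarrow> j \<in> I \<Longrightarrow> X j i = - X i j"
    using rep unfolding skew_rep_def by blast+
  obtain Z where Z: "finite Z" "\<And>\<alpha>. \<alpha> \<notin> Z \<Longrightarrow> inj_cols {..<m} I (\<lambda>a i. poly (N i a) \<alpha>)"
    using gen unfolding generically_indep_def by blast
  \<comment> \<open>At a generic point \<open>N\<close> is independent as well, so \<open>P\<close>
    has \<open>card I\<close> independent columns there.\<close>
  obtain \<alpha> where "\<alpha> \<notin> Z" using ex_new_if_finite[OF infinite_UNIV_char_0 Z(1)] by blast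
  then have N: "inj_cols {..<m} I (\<lambda>a i. grade_eval (n i) (Some \<alpha>) (N i a))" using Z(2) by simp
  obtain J where J: "J \<subseteq> {..<m}" "card J = card I" "inj_cols {..<m} J (\<lambda>a b. grade_eval (int d) (Some \<alpha>) (?P a b))"
    by (rule skew_rep_inj_cols[OF rep spec[OF X] N])
  then have "card J \<le> normal_rank m P" by (intro normal_rank_ge_at_point[OF Pc]) auto
  then have le: "card I \<le> 2 * r" using rank J by simp
  have "even (card I)"
  proof (rule ccontr)
    assume odd: "odd (card I)"
    have "\<not> inj_cols I I (\<lambda>i j. grade_eval (int d - n i - n j) (Some 0) (X i j))"
    proof (rule skew_odd_not_inj_cols[OF I odd])
      fix i j assume "i \<in> I" "j \<in> I"
      then have "X j i = - X i j" by (rule skew)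
      then show "grade_eval (int d - n j - n i) (Some 0) (X j i) = - grade_eval (int d - n i - n j) (Some 0) (X i j)"
        by simp
    qed
    then show False using spec[OF X, of "Some 0"] by (simp add: nonsingular_at_def)
  qed
  then obtain s where s: "card I = 2 * s" by blast
  then have "card I + 2 * (r - s) = 2 * r" using le by simp
  then obtain I' n' N' X' where "skew_rep d m ?P I' n' N' X'" "\<forall>x. nonsingular_at d I' n' X' x" "card I' = 2 * r"
    using skew_rep_pad_to[OF rep X, of "r - s"] r by auto
  then show ?thesis using that by blast
qed

section \<open>Density and closedness\<close>

lemma tendsto_pol_dist_0:
  assumes "\<And>a b l. a < m \<Longrightarrow> b < m \<Longrightarrow> (\<lambda>k. coeff (Q k $$ (a, b)) l) \<longlonglongrightarrow> coeff (P $$ (a, b)) l"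
  shows "(\<lambda>k. pol_dist d m P (Q k)) \<longlonglongrightarrow> 0"
proof -
  let ?A = "{..d} \<times> {..<m} \<times> {..<m}"
  have "(\<lambda>k. sqrt (\<Sum>z\<in>?A. (cmod (coeff (P $$ (fst (snd z), snd (snd z))) (fst z) -
      coeff (Q k $$ (fst (snd z), snd (snd z))) (fst z)))\<^sup>2)) \<longlonglongrightarrow> sqrt (\<Sum>z\<in>?A. (cmod (coeff (P $$ (fst (snd z), snd (snd z))) (fst z) -
      coeff (P $$ (fst (snd z), snd (snd z))) (fst z)))\<^sup>2)"
    by (intro tendsto_intros assms) auto
  then show ?thesis by (simp add: pol_dist_L2_set L2_set_def case_prod_unfold)
qed

text \<open>Only \<open>N\<close> is perturbed and \<open>X\<close> stays fixed. The coefficients of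
  \<open>N\<^sup>T X N\<close> depend continuously on those of \<open>N\<close>, so ever smaller
  perturbations give a sequence converging to \<open>P\<close>.\<close>

lemma POL_ss_rank_approx:
  assumes P: "P \<in> POL_ss_rank d (2 * r) m" and r: "2 \<le> 2 * r" "2 * r < m" and \<epsilon>: "\<epsilon> > 0"
  shows "\<exists>Q\<in>POL_ss_neig d (2 * r) m. pol_dist d m P Q < \<epsilon>"
proof -
  have ss: "P \<in> POL_ss d m" and rank: "normal_rank m P \<le> 2 * r" using P by (auto simp: POL_ss_rank_def)
  obtain I n N X where rep: "skew_rep d m (\<lambda>a b. P $$ (a, b)) I n N X"
    and X: "\<forall>x. nonsingular_at d I n X x" and card: "card I = 2 * r"
    by (rule skew_rep_exists[OF ss rank less_imp_le[OF r(2)]])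
  have I: "I \<subseteq> {..<m}" and n: "\<And>i. i \<in> I \<Longrightarrow> 0 \<le> n i"
    and N: "\<And>i a. i \<in> I \<Longrightarrow> a < m \<Longrightarrow> grade_le (n i) (N i a)"
    and Pe: "\<And>a b. a < m \<Longrightarrow> b < m \<Longrightarrow> P $$ (a, b) = (\<Sum>i\<in>I. \<Sum>j\<in>I. N i a * X i j * N j b)"
    using rep unfolding skew_rep_def by blast+
  have fin: "finite I" by (rule finite_subset[OF I]) simp
  have "\<forall>k. \<exists>N'. (\<forall>i\<in>I. \<forall>a<m. grade_le (n i) (N' i a) \<and> (\<forall>l. cmod (coeff (N' i a) l - coeff (N i a) l) < inverse (real (Suc k)))) \<and>
     (\<forall>x. inj_cols {..<m} I (\<lambda>a i. grade_eval (n i) x (N' i a)))"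
    using fin I card r n N by (intro allI perturb_rows) auto
  from choice[OF this] obtain N' where N': "\<And>k i a. i \<in> I \<Longrightarrow> a < m \<Longrightarrow> grade_le (n i) (N' k i a)"
    "\<And>k i a l. i \<in> I \<Longrightarrow> a < m \<Longrightarrow> cmod (coeff (N' k i a) l - coeff (N i a) l) < inverse (real (Suc k))"
    "\<And>k x. inj_cols {..<m} I (\<lambda>a i. grade_eval (n i) x (N' k i a))"
    by blast
  have lim: "(\<lambda>k. coeff (N' k i a) l) \<longlonglongrightarrow> coeff (N i a) l" if "i \<in> I" "a < m" for i a l
  proof (rule LIM_zero_cancel, rule Lim_null_comparison)
    show "\<forall>\<^sub>F k in sequentially. cmod (coeff (N' k i a) l - coeff (N i a) l) \<le> inverse (real (Suc k))"
      using N'(2)[OF that] by (intro always_eventually) (auto intro: less_imp_le)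
  qed (rule LIMSEQ_inverse_real_of_nat)
  define Q where "Q k = mat m m (\<lambda>(a, b). \<Sum>i\<in>I. \<Sum>j\<in>I. N' k i a * X i j * N' k j b)" for k
  have neig: "Q k \<in> POL_ss_neig d (2 * r) m" for k
  proof -
    have "skew_rep d m (\<lambda>a b. Q k $$ (a, b)) I n (N' k) X"
      unfolding skew_rep_def
    proof (intro conjI)
      show "\<forall>i\<in>I. \<forall>j\<in>I. grade_le (int d - n i - n j) (X i j)" "\<forall>i\<in>I. \<forall>j\<in>I. X j i = - X i j"
        using rep unfolding skew_rep_def by blast+
    qed (use I n N' in \<open>auto simp: Q_def\<close>)
    from skew_rep_POL_ss_neig[OF _ this spec[OF X] N'(3)] show ?thesis
      using card r by (simp add: Q_def)
  qed
  have "(\<lambda>k. pol_dist d m P (Q k)) \<longlonglongrightarrow> 0"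
  proof (rule tendsto_pol_dist_0)
    fix a b l assume ab: "a < m" "b < m"
    have "(\<lambda>k. coeff (\<Sum>i\<in>I. \<Sum>j\<in>I. N' k i a * X i j * N' k j b) l)
        \<longlonglongrightarrow> coeff (\<Sum>i\<in>I. \<Sum>j\<in>I. N i a * X i j * N j b) l"
      unfolding coeff_sum coeff_mult by (intro tendsto_intros lim ab)
    then show "(\<lambda>k. coeff (Q k $$ (a, b)) l) \<longlonglongrightarrow> coeff (P $$ (a, b)) l"
      using ab by (simp add: Q_def Pe)
  qed
  then have "\<forall>\<^sub>F k in sequentially. pol_dist d m P (Q k) < \<epsilon>" using \<epsilon> by (rule order_tendstoD(2))
  then obtain k where "pol_dist d m P (Q k) < \<epsilon>" by (auto simp: eventually_sequentially)
  then show ?thesis using neig by blast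
qed

lemma tendsto_det:
  fixes A :: "nat \<Rightarrow> complex mat"
  assumes "\<And>k. A k \<in> carrier_mat n n" "B \<in> carrier_mat n n"
    and "\<And>i j. i < n \<Longrightarrow> j < n \<Longrightarrow> (\<lambda>k. A k $$ (i, j)) \<longlonglongrightarrow> B $$ (i, j)"
  shows "(\<lambda>k. det (A k)) \<longlonglongrightarrow> det B"
  unfolding det_def'[OF assms(1)] det_def'[OF assms(2)]
proof (intro tendsto_sum tendsto_mult tendsto_const tendsto_prod assms(3))
  fix p i assume "p \<in> {p. p permutes {0..<n}}" "i \<in> {0..<n}"
  then show "i < n" "p i < n" using permutes_in_image by fastforce+
qed

text \<open>If \<open>P\<close> had larger rank, some minor of order greater than \<open>r\<close>
  would be nonzero at a point \<alpha>. That value is the limit of the same minors of the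
  approximating polynomials, all of which are zero.\<close>

lemma normal_rank_limit_le:
  assumes P: "P \<in> POL_ss d m" and approx: "\<And>\<epsilon>. \<epsilon> > 0 \<Longrightarrow> \<exists>Q\<in>POL_ss_rank d r m. pol_dist d m P Q < \<epsilon>"
  shows "normal_rank m P \<le> r"
proof (rule ccontr)
  assume gt: "\<not> normal_rank m P \<le> r"
  have Pc: "P \<in> carrier_mat m m" using P unfolding POL_ss_iff by blast
  obtain R J where R: "R \<subseteq> {..<m}" and J: "J \<subseteq> {..<m}" and RJ: "card R = card J" "card J = normal_rank m P"
    and det: "det (submatrix P R J) \<noteq> 0"
    by (rule normal_rank_minor[OF Pc])
  obtain \<alpha> where \<alpha>: "poly (det (submatrix P R J)) \<alpha> \<noteq> 0"
    using det poly_all_0_iff_0 by blast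
  have "\<forall>k. \<exists>Q. Q \<in> POL_ss_rank d r m \<and> pol_dist d m P Q < inverse (real (Suc k))"
    using approx[of "inverse (real (Suc _))"] by (simp add: Bex_def)
  from choice[OF this] obtain Q where Q: "\<And>k. Q k \<in> POL_ss_rank d r m"
    and close: "\<And>k. pol_dist d m P (Q k) < inverse (real (Suc k))" by blast
  have Qss: "Q k \<in> POL_ss d m" and Qr: "normal_rank m (Q k) \<le> r" for k using Q by (auto simp: POL_ss_rank_def)
  have Qc: "Q k \<in> carrier_mat m m" for k using Qss[of k] unfolding POL_ss_iff by blast
  have lim: "(\<lambda>k. coeff (Q k $$ (a, b)) l) \<longlonglongrightarrow> coeff (P $$ (a, b)) l" if "a < m" "b < m" "l \<le> d" for a b l
  proof (rule LIM_zero_cancel, rule Lim_null_comparison)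
    have "cmod (coeff (Q k $$ (a, b)) l - coeff (P $$ (a, b)) l) \<le> pol_dist d m P (Q k)" for k
      unfolding pol_dist_L2_set
      using member_le_L2_set[of "{..d} \<times> {..<m} \<times> {..<m}" "(l, a, b)"
          "\<lambda>(i, j, h). cmod (coeff (P $$ (j, h)) i - coeff (Q k $$ (j, h)) i)"] that
      by (simp add: norm_minus_commute)
    then show "\<forall>\<^sub>F k in sequentially. cmod (coeff (Q k $$ (a, b)) l - coeff (P $$ (a, b)) l) \<le> inverse (real (Suc k))"
      using close by (intro always_eventually allI) (meson less_imp_le order_trans)
  qed (rule LIMSEQ_inverse_real_of_nat)
  have plim: "(\<lambda>k. poly (Q k $$ (a, b)) \<alpha>) \<longlonglongrightarrow> poly (P $$ (a, b)) \<alpha>" if ab: "a < m" "b < m" for a b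
  proof -
    have g: "grade_le (int d) (P $$ (a, b))" "grade_le (int d) (Q k $$ (a, b))" for k
      using P Qss[of k] ab unfolding POL_ss_iff by blast+
    show ?thesis
      unfolding poly_eq_sum_grade[OF g(1)] poly_eq_sum_grade[OF g(2)]
      by (intro tendsto_intros lim ab) auto
  qed
  let ?ev = "map_mat (\<lambda>p. poly p \<alpha>)"
  have "(\<lambda>k. det (?ev (submatrix (Q k) R J))) \<longlonglongrightarrow> det (?ev (submatrix P R J))"
  proof (rule tendsto_det)
    show "?ev (submatrix (Q k) R J) \<in> carrier_mat (card J) (card J)" for k
      using submatrix_carrier_subset[OF Qc R J] RJ by simp
    show "?ev (submatrix P R J) \<in> carrier_mat (card J) (card J)"
      using submatrix_carrier_subset[OF Pc R J] RJ by simp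
    fix i j assume ij: "i < card J" "j < card J"
    then have "pick R i < m" "pick J j < m" using R J RJ pick_in_set_le by (metis lessThan_iff subsetD)+
    then have "(\<lambda>k. poly (Q k $$ (pick R i, pick J j)) \<alpha>) \<longlonglongrightarrow> poly (P $$ (pick R i, pick J j)) \<alpha>"
      by (rule plim)
    moreover have "?ev (submatrix (Q k) R J) $$ (i, j) = poly (Q k $$ (pick R i, pick J j)) \<alpha>" for k
      using ij RJ submatrix_carrier_subset[OF Qc[of k] R J] by (simp add: submatrix_index_subset[OF Qc R J])
    moreover have "?ev (submatrix P R J) $$ (i, j) = poly (P $$ (pick R i, pick J j)) \<alpha>"
      using ij RJ submatrix_carrier_subset[OF Pc R J] by (simp add: submatrix_index_subset[OF Pc R J])
    ultimately show "(\<lambda>k. ?ev (submatrix (Q k) R J) $$ (i, j)) \<longlonglongrightarrow> ?ev (submatrix P R J) $$ (i, j)"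
      by simp
  qed
  moreover have "det (?ev (submatrix (Q k) R J)) = 0" for k
  proof -
    have "det (submatrix (Q k) R J) = 0"
      using normal_rank_ge_minor[OF Qc R J, of k] Qr[of k] RJ gt by linarith
    then show ?thesis by (simp add: poly_det[symmetric])
  qed
  ultimately have "det (?ev (submatrix P R J)) = 0" by (simp add: LIMSEQ_const_iff)
  then show False using \<alpha> by (simp add: poly_det)
qed

theorem lemma3p4:
  fixes m r d :: nat
  assumes "d \<ge> 1" and "2 \<le> 2 * r" and "2 * r \<le> m - 1"
  shows "Metric_space.mtopology (POL_ss d m) (pol_dist d m) closure_of POL_ss_neig d (2 * r) m
    = POL_ss_rank d (2 * r) m"
proof -
  interpret Metric_space "POL_ss d m" "pol_dist d m" by (rule Metric_space_POL_ss)
  have sub: "POL_ss_neig d (2 * r) m \<subseteq> POL_ss_rank d (2 * r) m" "POL_ss_rank d (2 * r) m \<subseteq> POL_ss d m"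
    by (auto simp: POL_ss_neig_def POL_ss_rank_def)
  have "P \<in> POL_ss_rank d (2 * r) m \<longleftrightarrow>
      P \<in> POL_ss d m \<and> (\<forall>\<epsilon>>0. \<exists>Q\<in>POL_ss_neig d (2 * r) m. Q \<in> mball P \<epsilon>)" for P
  proof
    assume P: "P \<in> POL_ss_rank d (2 * r) m"
    \<comment> \<open>The truncated \<open>m - 1\<close> is harmless: as it is at least 2, the
      assumptions give \<open>2 * r < m\<close>.\<close>
    have "\<exists>Q\<in>POL_ss_neig d (2 * r) m. Q \<in> mball P \<epsilon>" if "\<epsilon> > 0" for \<epsilon>
      using POL_ss_rank_approx[OF P _ _ that] assms sub P by (force simp: in_mball)
    then show "P \<in> POL_ss d m \<and> (\<forall>\<epsilon>>0. \<exists>Q\<in>POL_ss_neig d (2 * r) m. Q \<in> mball P \<epsilon>)"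
      using P sub by blast
  next
    assume P: "P \<in> POL_ss d m \<and> (\<forall>\<epsilon>>0. \<exists>Q\<in>POL_ss_neig d (2 * r) m. Q \<in> mball P \<epsilon>)"
    then have "normal_rank m P \<le> 2 * r"
      using sub by (intro normal_rank_limit_le) (auto simp: in_mball, blast)
    then show "P \<in> POL_ss_rank d (2 * r) m" using P by (simp add: POL_ss_rank_def)
  qed
  then show ?thesis unfolding metric_closure_of by blast
qed

end
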